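(* Let $T=(V,E)$ be a tree and let $\{\langle X_t,G_t\rangle\}_{t\ge 0}$, $G_t=(V,E,C_t)$, be a proper, monotone increasing, possibly adaptive random walk in changing environment on $T$. Suppose that it is bounded from above by some recurrent weighted tree $G_\infty=(V,E,C_\infty)$ (that is, $C_t(e)\le C_\infty(e)$ for all $e\in E$ and all $t$, almost surely). Then the walk is recurrent, i.e. almost surely $X_t$ visits every vertex of $T$ infinitely many times.
   Context: A random walk in changing environment (RWCE) on a graph $G=(V,E)$ is a stochastic process $\{\langle X_t,G_t\rangle\}_{t=0}^\infty$ where $X_t\in V$ and $G_t=(V,E,C_t)$ is the graph $G$ equipped with a (random) conductance function $C_t:E\to[0,\infty)$, with total conductance at each vertex finite, such that for all $t$ and $v$, $$\mathbb{P}(X_{t+1}=v\mid \langle X_0,G_0\rangle,\dots,\langle X_t,G_t\rangle)=\frac{C_t(X_t,v)}{\sum_{e\in E: X_t\in e}C_t(e)}.$$ The conductances $C_t$ may depend on the whole history of the process and on extra randomness; "possibly adaptive" means no restriction is placed on this dependence. The RWCE is proper if $0<C_t(e)<\infty$ for all $t$ and $e$. It is monotone increasing if $C_{t+1}\ge C_t$ (edgewise) almost surely for all $t$. A fixed (deterministic) weighted graph, with finite total conductance at each vertex, is called recurrent if the usual weighted (reversible) random walk on it is recurrent. *)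

theory Defs
  imports "HOL-Probability.Probability"
begin

section \<open>Trees\<close>

text \<open>Simple undirected graphs, possibly infinite and not necessarily locally finite; an edge is
  the two-element set of its end points.\<close>

definition simple_graph :: "'v set \<Rightarrow> 'v set set \<Rightarrow> bool" where
  "simple_graph V E \<longleftrightarrow> E \<subseteq> {{u, v} | u v. u \<in> V \<and> v \<in> V \<and> u \<noteq> v}"

definition connected_graph :: "'v set \<Rightarrow> 'v set set \<Rightarrow> bool" where
  "connected_graph V E \<longleftrightarrow>
     V \<noteq> {} \<and> (\<forall>u\<in>V. \<forall>v\<in>V. (u, v) \<in> {(x, y). {x, y} \<in> E}\<^sup>*)"

definition graph_cycle :: "'v set set \<Rightarrow> 'v list \<Rightarrow> bool" where
  "graph_cycle E vs \<longleftrightarrow> 3 \<le> length vs \<and> distinct vs \<and>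
     (\<forall>i<length vs. {vs ! i, vs ! (Suc i mod length vs)} \<in> E)"

definition tree_graph :: "'v set \<Rightarrow> 'v set set \<Rightarrow> bool" where
  "tree_graph V E \<longleftrightarrow>
     simple_graph V E \<and> connected_graph V E \<and> (\<nexists>vs. graph_cycle E vs)"

section \<open>Weighted graphs\<close>

definition conductance :: "'v set \<Rightarrow> 'v set set \<Rightarrow> ('v set \<Rightarrow> real) \<Rightarrow> bool" where
  "conductance V E c \<longleftrightarrow>
     (\<forall>e\<in>E. 0 \<le> c e) \<and> (\<forall>v\<in>V. c summable_on {e \<in> E. v \<in> e})"

definition total_conductance :: "'v set set \<Rightarrow> ('v set \<Rightarrow> real) \<Rightarrow> 'v \<Rightarrow> real" where
  "total_conductance E c u = (\<Sum>\<^sub>\<infinity>e\<in>{e \<in> E. u \<in> e}. c e)"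

definition transition_prob :: "'v set set \<Rightarrow> ('v set \<Rightarrow> real) \<Rightarrow> 'v \<Rightarrow> 'v \<Rightarrow> real" where
  "transition_prob E c u v = (if {u, v} \<in> E then c {u, v} else 0) / total_conductance E c u"

section \<open>Random walks in changing environment\<close>

text \<open>The sigma-algebra generated by \<open>\<langle>X\<^sub>0, G\<^sub>0\<rangle>, \<dots>, \<langle>X\<^sub>t, G\<^sub>t\<rangle>\<close>.  Values of a conductance
  function outside \<open>E\<close> carry no meaning and are discarded.\<close>

definition history ::
  "'a measure \<Rightarrow> 'v set \<Rightarrow> 'v set set \<Rightarrow> (nat \<Rightarrow> 'a \<Rightarrow> 'v) \<Rightarrow> (nat \<Rightarrow> 'a \<Rightarrow> 'v set \<Rightarrow> real)
     \<Rightarrow> nat \<Rightarrow> 'a measure" where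
  "history M V E X C t =
     vimage_algebra (space M) (\<lambda>\<omega>. \<lambda>s\<in>{..t}. (X s \<omega>, restrict (C s \<omega>) E))
       (\<Pi>\<^sub>M s\<in>{..t}. count_space V \<Otimes>\<^sub>M (\<Pi>\<^sub>M e\<in>E. borel))"

text \<open>Only the law of the next position given the history is prescribed.  How \<open>C\<close> evolves is
  unrestricted: it may depend on the whole past of the walk and on any further randomness
  carried by \<open>M\<close>.\<close>

locale rwce = prob_space M
  for M :: "'a measure" +
  fixes V :: "'v set" and E :: "'v set set"
    and X :: "nat \<Rightarrow> 'a \<Rightarrow> 'v" and C :: "nat \<Rightarrow> 'a \<Rightarrow> 'v set \<Rightarrow> real"
  assumes measurable_position: "\<And>t. X t \<in> measurable M (count_space V)"
    and measurable_conductance: "\<And>t e. e \<in> E \<Longrightarrow> (\<lambda>\<omega>. C t \<omega> e) \<in> borel_measurable M"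
    and conductance: "AE \<omega> in M. \<forall>t. conductance V E (C t \<omega>)"
    and step: "\<And>t v. v \<in> V \<Longrightarrow>
      AE \<omega> in M. real_cond_exp M (history M V E X C t)
                    (indicator {\<omega>' \<in> space M. X (Suc t) \<omega>' = v}) \<omega>
                 = transition_prob E (C t \<omega>) (X t \<omega>) v"

definition proper :: "'a measure \<Rightarrow> 'v set set \<Rightarrow> (nat \<Rightarrow> 'a \<Rightarrow> 'v set \<Rightarrow> real) \<Rightarrow> bool" where
  "proper M E C \<longleftrightarrow> (AE \<omega> in M. \<forall>t. \<forall>e\<in>E. 0 < C t \<omega> e)"

definition monotone_increasing ::
  "'a measure \<Rightarrow> 'v set set \<Rightarrow> (nat \<Rightarrow> 'a \<Rightarrow> 'v set \<Rightarrow> real) \<Rightarrow> bool" where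
  "monotone_increasing M E C \<longleftrightarrow> (\<forall>t. AE \<omega> in M. \<forall>e\<in>E. C t \<omega> e \<le> C (Suc t) \<omega> e)"

definition recurrent_walk :: "'a measure \<Rightarrow> 'v set \<Rightarrow> (nat \<Rightarrow> 'a \<Rightarrow> 'v) \<Rightarrow> bool" where
  "recurrent_walk M V X \<longleftrightarrow> (AE \<omega> in M. \<forall>v\<in>V. infinite {t. X t \<omega> = v})"

text \<open>The usual weighted random walk on \<open>(V, E, c)\<close> is the one whose environment is constantly
  \<open>c\<close>.  Since HOL cannot quantify over the type of the sample space, the walks are realised on the
  path space \<open>nat \<Rightarrow> 'v\<close>; \<open>weighted_walk_exists\<close> below shows that such a walk exists from
  every starting point, so that the quantification is not vacuous.\<close>

definition recurrent_graph :: "'v set \<Rightarrow> 'v set set \<Rightarrow> ('v set \<Rightarrow> real) \<Rightarrow> bool" where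
  "recurrent_graph V E c \<longleftrightarrow> conductance V E c \<and>
     (\<forall>(M :: (nat \<Rightarrow> 'v) measure) X. rwce M V E X (\<lambda>t \<omega>. c) \<longrightarrow> recurrent_walk M V X)"

lemma transition_prob_has_sum:
  assumes "simple_graph V E" and "conductance V E c" and "u \<in> V"
    and pos: "0 < total_conductance E c u"
  shows "(transition_prob E c u has_sum 1) V"
proof -
  let ?N = "{v \<in> V. {u, v} \<in> E}"
  have bij: "bij_betw (\<lambda>v. {u, v}) ?N {e \<in> E. u \<in> e}"
    unfolding bij_betw_def
  proof
    show "inj_on (\<lambda>v. {u, v}) ?N"
      by (auto simp: inj_on_def doubleton_eq_iff)
    show "(\<lambda>v. {u, v}) ` ?N = {e \<in> E. u \<in> e}"
    proof (intro set_eqI iffI)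
      fix e assume "e \<in> {e \<in> E. u \<in> e}"
      moreover then obtain a b where "e = {a, b}" "a \<in> V" "b \<in> V"
        using assms(1) unfolding simple_graph_def by blast
      ultimately have "e = {u, b} \<and> b \<in> V \<or> e = {u, a} \<and> a \<in> V" "e \<in> E" by auto
      then show "e \<in> (\<lambda>v. {u, v}) ` ?N" by blast
    qed auto
  qed
  have "(c has_sum total_conductance E c u) {e \<in> E. u \<in> e}"
    using assms(2,3) unfolding conductance_def total_conductance_def
    by (intro has_sum_infsum) auto
  then have "((\<lambda>v. c {u, v}) has_sum total_conductance E c u) ?N"
    using has_sum_reindex_bij_betw[OF bij, of c] by simp
  then have "((\<lambda>v. c {u, v} * (1 / total_conductance E c u))
      has_sum total_conductance E c u * (1 / total_conductance E c u)) ?N"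
    by (rule has_sum_cmult_left)
  then have "(transition_prob E c u has_sum 1) ?N"
    using pos by (subst has_sum_cong[where g="\<lambda>v. c {u, v} * (1 / total_conductance E c u)"])
      (auto simp: transition_prob_def)
  then show ?thesis
    by (subst has_sum_cong_neutral[where T="?N" and g="transition_prob E c u"])
      (auto simp: transition_prob_def)
qed

lemma transition_prob_nonneg:
  assumes "conductance V E c" and "u \<in> V"
  shows "0 \<le> transition_prob E c u v"
  using assms unfolding transition_prob_def total_conductance_def conductance_def
  by (auto intro!: divide_nonneg_nonneg infsum_nonneg)

lemma weighted_walk_exists:
  fixes V :: "'v set"
  assumes G: "simple_graph V E" and c: "conductance V E c"
    and pos: "\<And>u. u \<in> V \<Longrightarrow> 0 < total_conductance E c u" and x: "x \<in> V"
  shows "\<exists>(M :: (nat \<Rightarrow> 'v) measure) X.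
    rwce M V E X (\<lambda>t \<omega>. c) \<and> (AE \<omega> in M. X 0 \<omega> = x)"
proof -
  define p where "p = transition_prob E c"
  have p0: "0 \<le> p u v" if "u \<in> V" for u v
    unfolding p_def by (rule transition_prob_nonneg[OF c that])
  have p_sum: "(p u has_sum 1) V" if "u \<in> V" for u
    unfolding p_def by (rule transition_prob_has_sum[OF G c that pos[OF that]])
  define K where "K u = density (count_space V) (\<lambda>v. ennreal (p u v))" for u
  have K_emeasure: "emeasure (K u) A = (\<integral>\<^sup>+v. ennreal (p u v) * indicator A v \<partial>count_space V)"
    if "A \<subseteq> V" for u A
    unfolding K_def using that by (subst emeasure_density) auto
  have K_prob: "prob_space (K u)" if "u \<in> V" for u
  proof (rule prob_spaceI)
    have "(\<integral>\<^sup>+v. ennreal (p u v) \<partial>count_space V) = ennreal (infsum (p u) V)"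
    proof -
      have "(\<lambda>v. norm (p u v)) summable_on V"
        using p_sum[OF that] p0[OF that] by (simp add: has_sum_imp_summable)
      moreover from this have "Infinite_Set_Sum.abs_summable_on (p u) V"
        by (simp add: abs_summable_equivalent[symmetric])
      ultimately show ?thesis
        using p0[OF that] by (simp add: nn_integral_conv_infsetsum infsetsum_infsum)
    qed
    also have "\<dots> = 1" using p_sum[OF that] by (simp add: infsumI)
    finally have "(\<integral>\<^sup>+v. ennreal (p u v) \<partial>count_space V) = 1" .
    moreover have "(\<integral>\<^sup>+v. ennreal (p u v) * indicator V v \<partial>count_space V) =
        (\<integral>\<^sup>+v. ennreal (p u v) \<partial>count_space V)"
      by (intro nn_integral_cong) simp
    moreover have "space (K u) = V" by (simp add: K_def)
    ultimately show "emeasure (K u) (space (K u)) = 1"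
      using K_emeasure[of V u] by simp
  qed

  define cs where "cs = (\<lambda>_::nat. count_space V)"
  define P where "P i \<omega> = (if i = 0 then return (count_space V) x else K (\<omega> (i - 1)))"
    for i :: nat and \<omega> :: "nat \<Rightarrow> 'v"
  have IT: "Ionescu_Tulcea P cs"
  proof (rule Ionescu_Tulcea.intro)
    show "prob_space (P i \<omega>)" if "\<omega> \<in> space (PiM {0..<i} cs)" for i \<omega>
      using that x by (cases i)
        (auto simp: P_def cs_def space_PiM PiE_iff intro!: prob_space_return K_prob)
    show "P i \<in> measurable (PiM {0..<i} cs) (subprob_algebra (cs i))" for i
    proof (cases i)
      case 0
      then have "P i = (\<lambda>_. return (count_space V) x)" by (simp add: P_def fun_eq_iff)
      then show ?thesis using x
        by (auto simp: cs_def space_subprob_algebra intro!: measurable_const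
            prob_space_imp_subprob_space prob_space_return)
    next
      case (Suc n)
      have "K \<in> measurable (count_space V) (subprob_algebra (count_space V))"
        using K_prob by (auto simp: space_subprob_algebra K_def prob_space_imp_subprob_space)
      moreover have "(\<lambda>\<omega>. \<omega> n) \<in> measurable (PiM {0..<i} cs) (count_space V)"
        using measurable_component_singleton[of n "{0..<i}" cs] Suc by (simp add: cs_def)
      ultimately have "(\<lambda>\<omega>. K (\<omega> n)) \<in> measurable (PiM {0..<i} cs) (subprob_algebra (count_space V))"
        by (rule measurable_compose[rotated])
      then show ?thesis using Suc by (simp add: P_def[abs_def] cs_def)
    qed
  qed

  interpret Ionescu_Tulcea P cs by (rule IT)

  define M where "M = PF.lim"
  have sets_M: "sets M = sets (PiM UNIV cs)"
    unfolding M_def by (rule PF.sets_lim)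
  have space_M: "space M = (\<Pi>\<^sub>E i\<in>UNIV. V)"
    using sets_eq_imp_space_eq[OF sets_M] by (simp add: space_PiM cs_def)
  have M_prob: "prob_space M"
  proof (rule prob_spaceI)
    have "space M = PF.emb UNIV {} (space (PiM {} cs))"
      by (auto simp: space_M prod_emb_def space_PiM cs_def)
    then have "emeasure M (space M) = emeasure (CI {}) (space (CI {}))"
      unfolding M_def by (simp add: lim CI_def)
    then show "emeasure M (space M) = 1"
      using PF.prob_space_P[of "{}"] by (simp add: prob_space.emeasure_space_1)
  qed
  interpret M: prob_space M by (rule M_prob)
  have X_meas: "(\<lambda>\<omega>. \<omega> t) \<in> measurable M (count_space V)" for t
    using measurable_component_singleton[of t UNIV cs]
    by (simp add: measurable_cong_sets[OF sets_M refl] cs_def)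
  define R where "R n \<omega> = restrict \<omega> {0..<n}" for n :: nat and \<omega> :: "nat \<Rightarrow> 'v"
  have R_meas[measurable]: "R n \<in> measurable M (PiM {0..<n} cs)" for n
    unfolding R_def[abs_def] measurable_cong_sets[OF sets_M refl]
    by (rule measurable_restrict_subset) simp
  have distr_R: "distr M (PiM {0..<n} cs) (R n) = C 0 n (\<lambda>_. undefined)" for n
  proof (rule measure_eqI)
    fix A assume "A \<in> sets (distr M (PiM {0..<n} cs) (R n))"
    then have A: "A \<in> sets (PiM {0..<n} cs)" by simp
    then have "emeasure (distr M (PiM {0..<n} cs) (R n)) A = emeasure M (R n -` A \<inter> space M)"
      by (simp add: emeasure_distr)
    also have "R n -` A \<inter> space M = PF.emb UNIV {0..<n} A"
      by (auto simp: prod_emb_def R_def[abs_def] space_M cs_def)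
    also have "emeasure M \<dots> = emeasure (CI {0..<n}) A"
      unfolding M_def using A by (intro lim) auto
    also have "\<dots> = emeasure (C 0 n (\<lambda>_. undefined)) A"
      using A sets.sets_into_space[OF A]
      by (subst emeasure_CI[where n=n]) (auto simp: prod_emb_id space_PiM)
    finally show "emeasure (distr M (PiM {0..<n} cs) (R n)) A = emeasure (C 0 n (\<lambda>_. undefined)) A" .
  qed (simp add: sets_C)

  have eP_und: "emeasure (C 0 (Suc n) (\<lambda>_. undefined)) A =
      (\<integral>\<^sup>+\<sigma>. emeasure (eP n \<sigma>) A \<partial>C 0 n (\<lambda>_. undefined))"
    if "A \<in> sets (PiM {0..<Suc n} cs)" for n A
  proof -
    have und: "(\<lambda>_. undefined) \<in> space (PiM {0..<0::nat} cs)" by (simp add: space_PiM)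
    have "eP n \<in> measurable (C 0 n (\<lambda>_. undefined)) (subprob_algebra (PiM {0..<Suc n} cs))"
      using measurable_eP[of n] by (simp add: measurable_cong_sets[OF sets_C[OF und, of n] refl])
    moreover have "space (C 0 n (\<lambda>_. undefined)) \<noteq> {}"
      using prob_space_C[OF und] by (rule prob_space.not_empty)
    ultimately show ?thesis
      using that by (simp add: emeasure_bind)
  qed

  have "AE \<omega> in M. \<omega> 0 = x"
  proof -
    let ?S = "{\<sigma> \<in> space (PiM {0..<Suc 0} cs). \<sigma> 0 = x}"
    have S: "?S \<in> sets (PiM {0..<Suc 0} cs)"
    proof -
      have "(\<lambda>\<sigma>. \<sigma> 0) \<in> measurable (PiM {0..<Suc 0} cs) (count_space V)"
        using measurable_component_singleton[of 0 "{0..<Suc 0}" cs] by (simp add: cs_def)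
      from measurable_sets[OF this, of "{x}"] x show ?thesis by (simp add: vimage_def Int_def conj_commute)
    qed
    have "emeasure M {\<omega> \<in> space M. \<omega> 0 = x} = emeasure M (R (Suc 0) -` ?S \<inter> space M)"
      by (intro arg_cong2[where f=emeasure] refl)
        (auto simp: R_def space_M space_PiM cs_def)
    also have "\<dots> = emeasure (C 0 (Suc 0) (\<lambda>_. undefined)) ?S"
      unfolding distr_R[symmetric] by (rule emeasure_distr[OF R_meas S, symmetric])
    also have "\<dots> = emeasure (eP 0 (\<lambda>_. undefined)) ?S"
    proof -
      have "(\<lambda>_. undefined) \<in> space (PiM {0..<0::nat} cs)" by (simp add: space_PiM)
      moreover have "(\<lambda>\<sigma>. emeasure (eP 0 \<sigma>) ?S) \<in> borel_measurable (PiM {0..<0} cs)"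
        by (rule measurable_emeasure_kernel[OF measurable_eP S])
      ultimately show ?thesis
        unfolding eP_und[OF S] C.simps(1) by (intro nn_integral_return) (auto simp: space_PiM)
    qed
    also have "\<dots> = 1"
    proof -
      have "(\<lambda>_. undefined) \<in> space (PiM {0..<0::nat} cs)" by (simp add: space_PiM)
      moreover have "((\<lambda>z. (\<lambda>_. undefined)(0 := z)) -` ?S \<inter> space (cs 0)) = {x}"
        using x by (auto simp: space_PiM cs_def PiE_iff extensional_def)
      ultimately show ?thesis
        using x emeasure_eP[of "\<lambda>_. undefined" 0 ?S] S by (simp add: P_def)
    qed
    finally have "measure M {\<omega> \<in> space M. \<omega> 0 = x} = 1"
      by (simp add: measure_def)
    from M.AE_prob_1[OF this] show ?thesis by eventually_elim simp
  qed

  have "rwce M V E (\<lambda>t \<omega>. \<omega> t) (\<lambda>t \<omega>. c)"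
  proof
    show "(\<lambda>\<omega>. \<omega> t) \<in> measurable M (count_space V)" for t by (rule X_meas)
    show "AE \<omega> in M. \<forall>t. conductance V E c" using c by simp
    fix t v assume v: "v \<in> V"
    let ?H = "history M V E (\<lambda>t \<omega>. \<omega> t) (\<lambda>t \<omega>. c) t"
    let ?D = "{\<omega>' \<in> space M. \<omega>' (Suc t) = v}"
    define N where
      "N = (\<Pi>\<^sub>M s\<in>{..t}. count_space V \<Otimes>\<^sub>M (\<Pi>\<^sub>M e\<in>E. (borel :: real measure)))"
    define h where "h \<omega> = (\<lambda>s\<in>{..t}. (\<omega> s, restrict c E))" for \<omega> :: "nat \<Rightarrow> 'v"
    have H: "?H = vimage_algebra (space M) h N"
      by (simp add: history_def h_def[abs_def] N_def)
    have h_meas: "h \<in> measurable L N"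
      if "\<And>s. s \<le> t \<Longrightarrow> (\<lambda>\<omega>. \<omega> s) \<in> measurable L (count_space V)" for L
      unfolding h_def[abs_def] N_def using that
      by (intro measurable_restrict measurable_Pair measurable_const)
        (auto simp: space_PiM)
    have hR: "h \<omega> = h (R (Suc t) \<omega>)" for \<omega> by (auto simp: h_def R_def)
    have sub: "subalgebra M ?H"
      unfolding subalgebra_def H by (simp add: sets_image_in_sets h_meas X_meas)
    interpret finite_measure_subalgebra M ?H
      by unfold_locales (rule sub)
    have Xt: "(\<lambda>\<omega>. \<omega> s) \<in> measurable ?H (count_space V)" if "s \<le> t" for s
    proof -
      have "h \<in> measurable ?H N"
        unfolding H using h_meas[of M] X_meas
        by (intro measurable_vimage_algebra1) (auto simp: measurable_def)
      moreover have "(\<lambda>z. fst (z s)) \<in> measurable N (count_space V)"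
        using that unfolding N_def
        by (intro measurable_compose[where g=fst, OF measurable_component_singleton[of s "{..t}"]]
            measurable_fst) simp
      ultimately have "(\<lambda>\<omega>. fst (h \<omega> s)) \<in> measurable ?H (count_space V)"
        by (rule measurable_compose)
      then show ?thesis using that by (simp add: h_def)
    qed
    have D: "?D \<in> sets M" using X_meas[of "Suc t"] v by measurable
    have g_meas: "(\<lambda>\<omega>. p (\<omega> t) v) \<in> borel_measurable ?H"
      by (rule measurable_compose[OF Xt]) auto
    have p1: "p u v \<le> 1" if "u \<in> V" for u
      using has_sum_mono2[OF has_sum_finite[of "{v}" "p u"] p_sum[OF that]] v p0[OF that] by auto
    have key: "emeasure M (A \<inter> ?D) = (\<integral>\<^sup>+\<omega>. ennreal (p (\<omega> t) v) * indicator A \<omega> \<partial>M)"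
      if A: "A \<in> sets ?H" for A
    proof -
      let ?n = "Suc t"
      have "h \<in> space M \<rightarrow> space N" using h_meas[of M] X_meas by (auto simp: measurable_def)
      then obtain B where B: "B \<in> sets N" and AB: "A = h -` B \<inter> space M"
        using A unfolding H by (auto simp: sets_vimage_algebra2)
      define A' where "A' = h -` B \<inter> space (PiM {0..<?n} cs)"
      have cs_comp: "(\<lambda>\<sigma>. \<sigma> s) \<in> measurable (PiM {0..<k} cs) (count_space V)" if "s < k" for s k
        using measurable_component_singleton[of s "{0..<k}" cs] that by (simp add: cs_def)
      have "h \<in> measurable (PiM {0..<?n} cs) N"
        by (rule h_meas) (auto intro: cs_comp)
      then have A': "A' \<in> sets (PiM {0..<?n} cs)"
        unfolding A'_def using B by (rule measurable_sets)
      have AA': "\<omega> \<in> A \<longleftrightarrow> R ?n \<omega> \<in> A'" if "\<omega> \<in> space M" for \<omega>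
        using that hR[of \<omega>] measurable_space[OF R_meas that, of ?n] by (auto simp: AB A'_def)
      define S where "S = {\<sigma> \<in> space (PiM {0..<Suc ?n} cs). R ?n \<sigma> \<in> A' \<and> \<sigma> ?n = v}"
      have S: "S \<in> sets (PiM {0..<Suc ?n} cs)"
      proof -
        have "R ?n \<in> measurable (PiM {0..<Suc ?n} cs) (PiM {0..<?n} cs)"
          unfolding R_def[abs_def] by (rule measurable_restrict_subset) auto
        from measurable_sets[OF this A'] measurable_sets[OF cs_comp[of ?n "Suc ?n"], of "{v}"] v
        have "(R ?n -` A' \<inter> space (PiM {0..<Suc ?n} cs)) \<inter>
            ((\<lambda>\<sigma>. \<sigma> ?n) -` {v} \<inter> space (PiM {0..<Suc ?n} cs)) \<in> sets (PiM {0..<Suc ?n} cs)"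
          by simp
        also have "(R ?n -` A' \<inter> space (PiM {0..<Suc ?n} cs)) \<inter>
            ((\<lambda>\<sigma>. \<sigma> ?n) -` {v} \<inter> space (PiM {0..<Suc ?n} cs)) = S"
          by (auto simp: S_def)
        finally show ?thesis .
      qed
      have RR: "R ?n (R (Suc ?n) \<omega>) = R ?n \<omega>" for \<omega> by (auto simp: R_def)
      have "A \<inter> ?D = R (Suc ?n) -` S \<inter> space M"
        using AA' measurable_space[OF R_meas, of _ "Suc ?n"]
        by (auto simp: S_def RR) (auto simp: R_def AB)+
      then have "emeasure M (A \<inter> ?D) = emeasure (distr M (PiM {0..<Suc ?n} cs) (R (Suc ?n))) S"
        using emeasure_distr[OF R_meas S] by simp
      also have "\<dots> = (\<integral>\<^sup>+\<sigma>. emeasure (eP ?n \<sigma>) S \<partial>distr M (PiM {0..<?n} cs) (R ?n))"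
        unfolding distr_R by (rule eP_und[OF S])
      also have "\<dots> = (\<integral>\<^sup>+\<sigma>. ennreal (p (\<sigma> t) v) * indicator A' \<sigma> \<partial>distr M (PiM {0..<?n} cs) (R ?n))"
      proof (rule nn_integral_cong)
        fix \<sigma> assume "\<sigma> \<in> space (distr M (PiM {0..<?n} cs) (R ?n))"
        then have \<sigma>: "\<sigma> \<in> space (PiM {0..<?n} cs)" by simp
        have "(\<lambda>z. \<sigma>(?n := z)) -` S \<inter> space (cs ?n) = (if \<sigma> \<in> A' then {v} else {})"
        proof -
          have "R ?n (\<sigma>(?n := z)) = \<sigma>" for z
            using \<sigma> by (auto simp: R_def space_PiM PiE_iff extensional_def fun_eq_iff)
          moreover have "\<sigma>(?n := z) \<in> space (PiM {0..<Suc ?n} cs)" if "z \<in> V" for z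
            using \<sigma> that by (auto simp: space_PiM PiE_iff extensional_def cs_def)
          ultimately show ?thesis using v by (auto simp: S_def cs_def)
        qed
        then have "emeasure (eP ?n \<sigma>) S = (if \<sigma> \<in> A' then emeasure (K (\<sigma> t)) {v} else 0)"
          by (simp add: emeasure_eP[OF \<sigma> S] P_def)
        also have "emeasure (K (\<sigma> t)) {v} = ennreal (p (\<sigma> t) v)"
          using v by (simp add: K_emeasure nn_integral_count_space_indicator nn_integral_indicator_singleton)
        finally show "emeasure (eP ?n \<sigma>) S = ennreal (p (\<sigma> t) v) * indicator A' \<sigma>" by simp
      qed
      also have "\<dots> = (\<integral>\<^sup>+\<omega>. ennreal (p (R ?n \<omega> t) v) * indicator A' (R ?n \<omega>) \<partial>M)"
      proof -
        have "(\<lambda>\<sigma>. p (\<sigma> t) v) \<in> borel_measurable (PiM {0..<?n} cs)"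
          by (rule measurable_compose[OF cs_comp]) auto
        then have "(\<lambda>\<sigma>. ennreal (p (\<sigma> t) v) * indicator A' \<sigma>) \<in> borel_measurable (PiM {0..<?n} cs)"
          using A' by measurable
        then show ?thesis by (intro nn_integral_distr[OF R_meas]) simp
      qed
      also have "\<dots> = (\<integral>\<^sup>+\<omega>. ennreal (p (\<omega> t) v) * indicator A \<omega> \<partial>M)"
        by (intro nn_integral_cong) (auto simp: AA' R_def indicator_def)
      finally show ?thesis .
    qed
    have "AE \<omega> in M. real_cond_exp M ?H (indicator ?D) \<omega> = p (\<omega> t) v"
    proof (rule real_cond_exp_charact)
      have gM: "(\<lambda>\<omega>. p (\<omega> t) v) \<in> borel_measurable M"
        using g_meas sub by (rule measurable_from_subalg[rotated])
      show "integrable M (indicator ?D :: _ \<Rightarrow> real)"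
        using D by (intro M.integrable_const_bound[where B=1]) auto
      have p_bounds: "0 \<le> p (\<omega> t) v \<and> p (\<omega> t) v \<le> 1" if "\<omega> \<in> space M" for \<omega>
        using that p0[of "\<omega> t" v] p1[of "\<omega> t"] by (auto simp: space_M PiE_iff)
      show "integrable M (\<lambda>\<omega>. p (\<omega> t) v)"
        using gM p_bounds by (intro M.integrable_const_bound[where B=1] AE_I2) auto
      show "(\<lambda>\<omega>. p (\<omega> t) v) \<in> borel_measurable ?H" by (rule g_meas)
      fix A assume A: "A \<in> sets ?H"
      then have AM: "A \<in> sets M" using sub by (auto simp: subalgebra_def)
      have 1: "(LINT \<omega>:A|M. indicator ?D \<omega> :: real) = measure M (A \<inter> ?D)"
        using AM D by (simp add: set_lebesgue_integral_def indicator_inter_arith[symmetric])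
      have "ennreal (measure M (A \<inter> ?D)) = (\<integral>\<^sup>+\<omega>. ennreal (p (\<omega> t) v) * indicator A \<omega> \<partial>M)"
        using key[OF A] by (simp add: M.emeasure_eq_measure)
      also have "\<dots> = (\<integral>\<^sup>+\<omega>. ennreal (indicator A \<omega> * p (\<omega> t) v) \<partial>M)"
        by (intro nn_integral_cong) (auto simp: indicator_def)
      finally have 2: "ennreal (measure M (A \<inter> ?D)) = (\<integral>\<^sup>+\<omega>. ennreal (indicator A \<omega> * p (\<omega> t) v) \<partial>M)" .
      have "measure M (A \<inter> ?D) = (\<integral>\<omega>. indicator A \<omega> * p (\<omega> t) v \<partial>M)"
        using gM AM p_bounds
        by (subst integral_eq_nn_integral) (auto simp: 2[symmetric] intro!: AE_I2)
      then show "(LINT \<omega>:A|M. indicator ?D \<omega> :: real) = (LINT \<omega>:A|M. p (\<omega> t) v)"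
        using 1 by (simp add: set_lebesgue_integral_def)
    qed
    then show "AE \<omega> in M. real_cond_exp M ?H (indicator ?D) \<omega> = transition_prob E c (\<omega> t) v"
      by (simp add: p_def)
  qed auto
  then show ?thesis using \<open>AE \<omega> in M. \<omega> 0 = x\<close> by blast
qed

end

theory Submission
  imports Defs
begin

text \<open>Root the tree.  Among the functions that vanish at the root, increase away from it, are
  superharmonic for \<open>C\<^sub>\<infinity>\<close> off the root and equal \<open>1\<close> off a finite set \<open>B\<close>, let \<open>u\<close> be the least.
  As \<open>B\<close> exhausts \<open>V\<close>, the functions \<open>u\<close> decrease to a bounded function harmonic off the root, which
  is \<open>0\<close> by recurrence.  On a tree, superharmonicity only concerns the flow \<open>\<theta> = C\<^sub>\<infinity> du\<close>: it is lost on
  the way from the root, never gained.  So the \<^emph>\<open>same\<close> flow yields, for each environment \<open>C\<^sub>t\<close>, a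
  potential \<open>W\<^sub>t(x) = \<Sum> \<theta>(e) / C\<^sub>t(e)\<close>, summed over the path from the root to \<open>x\<close>, that is superharmonic
  for \<open>C\<^sub>t\<close>.  Since \<open>C\<^sub>t\<close> increases, \<open>W\<^sub>t\<close> decreases in \<open>t\<close>, and \<open>W\<^sub>t(X\<^sub>t)\<close> is a supermartingale until
  the root is hit.  It starts from a value that vanishes as \<open>B\<close> exhausts \<open>V\<close>, but is at least
  \<open>u = 1\<close> when the walk is outside \<open>B\<close>, so the walk cannot escape to infinity while avoiding the root.
  Hence some vertex is visited infinitely often, and then so are all its neighbours.\<close>

section \<open>Rooted trees\<close>

text \<open>The map \<open>x \<mapsto> {x, par x}\<close> is a bijection from the non-root vertices
  to the edges, so flows on edges can be written as functions of vertices. The depth certifies that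
  chains of parents end at the root; \<open>par root\<close> is left arbitrary.\<close>

locale rooted_tree =
  fixes V :: "'v set" and E :: "'v set set" and root :: 'v
    and par :: "'v \<Rightarrow> 'v" and depth :: "'v \<Rightarrow> nat"
  assumes root_in: "root \<in> V"
    and depth_root: "depth root = 0"
    and par_in: "\<And>x. x \<in> V \<Longrightarrow> x \<noteq> root \<Longrightarrow> par x \<in> V"
    and depth_par: "\<And>x. x \<in> V \<Longrightarrow> x \<noteq> root \<Longrightarrow> depth x = Suc (depth (par x))"
    and edges: "E = (\<lambda>x. {x, par x}) ` (V - {root})"

text \<open>The depth is the graph distance from \<open>r\<close>, and a parent is any neighbour one
  step closer. Acyclicity is used only to see that every edge joins a vertex to its parent:
  otherwise the ancestor chains of its end points, up to their first meeting, would close to a cycle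
  with that edge.\<close>

lemma tree_graph_rooted:
  assumes T: "tree_graph V E" and r: "r \<in> V"
  obtains par depth where "rooted_tree V E r par depth"
proof -
  define R where "R = {(x, y). {x, y} \<in> E}"
  define d where "d x = (LEAST n. (r, x) \<in> R ^^ n)" for x
  have simple: "u \<in> V \<and> v \<in> V \<and> u \<noteq> v" if "{u, v} \<in> E" for u v
    using T that unfolding tree_graph_def simple_graph_def by (fastforce simp: doubleton_eq_iff)
  have reach: "(r, x) \<in> R ^^ d x" if "x \<in> V" for x
  proof -
    have "(r, x) \<in> R\<^sup>*" using T r that unfolding tree_graph_def connected_graph_def R_def by blast
    then obtain n where "(r, x) \<in> R ^^ n" by (auto simp: rtrancl_power)
    then show ?thesis unfolding d_def by (rule LeastI)
  qed
  have d_le: "d x \<le> n" if "(r, x) \<in> R ^^ n" for x n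
    unfolding d_def using that by (rule Least_le)
  have d_r: "d r = 0" using d_le[of r 0] by simp
  have d_0: "x = r" if "x \<in> V" "d x = 0" for x using reach[OF that(1)] that(2) by simp
  have ex: "\<exists>y. {x, y} \<in> E \<and> d x = Suc (d y)" if x: "x \<in> V" "x \<noteq> r" for x
  proof -
    obtain m where m: "d x = Suc m" using d_0 x by (cases "d x") auto
    with reach[OF x(1)] obtain y where y: "(r, y) \<in> R ^^ m" "(y, x) \<in> R" by auto
    have "y \<in> V" using y(2) simple by (auto simp: R_def)
    from relpow_Suc_I[OF reach[OF this] y(2)] have "d x \<le> Suc (d y)" by (rule d_le)
    with d_le[OF y(1)] m y(2) show ?thesis by (auto simp: R_def insert_commute)
  qed
  define par where "par x = (SOME y. {x, y} \<in> E \<and> d x = Suc (d y))" for x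
  have par: "{x, par x} \<in> E \<and> d x = Suc (d (par x))" if "x \<in> V" "x \<noteq> r" for x
    unfolding par_def by (rule someI_ex[OF ex[OF that]])
  have par_in: "par x \<in> V" if "x \<in> V" "x \<noteq> r" for x using par[OF that] simple by blast
  have up: "(par ^^ k) x \<in> V \<and> d ((par ^^ k) x) = d x - k" if "x \<in> V" "k \<le> d x" for x k
    using that(2)
  proof (induction k)
    case 0
    then show ?case using that by simp
  next
    case (Suc k)
    then have IH: "(par ^^ k) x \<in> V" "d ((par ^^ k) x) = d x - k" by auto
    with Suc.prems d_r have "(par ^^ k) x \<noteq> r" by (auto intro!: notI)
    from par[OF IH(1) this] par_in[OF IH(1) this] IH(2) show ?case by auto
  qed
  have up_edge: "{(par ^^ k) x, (par ^^ Suc k) x} \<in> E" if "x \<in> V" "k < d x" for x k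
  proof -
    have "d ((par ^^ k) x) \<noteq> 0" using up[of x k] that by simp
    then have "(par ^^ k) x \<noteq> r" using d_r by auto
    then show ?thesis using par[of "(par ^^ k) x"] up[of x k] that by simp
  qed
  have up_inj: "a = b" if "x \<in> V" "a \<le> d x" "b \<le> d x" "(par ^^ a) x = (par ^^ b) x" for x a b
  proof -
    have "d x - a = d x - b" using up[of x a] up[of x b] that by metis
    then show ?thesis using that by simp
  qed
  have tree_edge: "x \<noteq> r \<and> y = par x \<or> y \<noteq> r \<and> x = par y" if xy: "{x, y} \<in> E" for x y
  proof (rule ccontr)
    assume neg: "\<not> ?thesis"
    have V: "x \<in> V" "y \<in> V" "x \<noteq> y" using simple[OF xy] by auto
    \<comment> \<open>\<open>P (i, j)\<close> says that the chains meet after \<open>i\<close> steps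
      from \<open>x\<close> and \<open>j\<close> steps from \<open>y\<close>; they do so at
      \<open>r\<close> at the latest. Minimising \<open>i + j\<close> makes them disjoint before the
      meeting point.\<close>
    define P where "P = (\<lambda>(i, j). i \<le> d x \<and> j \<le> d y \<and> (par ^^ i) x = (par ^^ j) y)"
    have "P (d x, d y)" using up[of x "d x"] up[of y "d y"] V d_0 by (auto simp: P_def)
    from ex_has_least_nat[of P, OF this, of "\<lambda>(i, j). i + j"]
    obtain i j where ij: "P (i, j)" and least: "\<And>a b. P (a, b) \<Longrightarrow> i + j \<le> a + b" by auto
    then have i: "i \<le> d x" and j: "j \<le> d y" and eq: "(par ^^ i) x = (par ^^ j) y"
      by (auto simp: P_def)
    \<comment> \<open>The walk up from \<open>x\<close> to the meeting point and down to
      \<open>y\<close>; both formulas agree at \<open>k = i\<close>, which is why the list below has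
      \<open>i + j + 1\<close> entries.\<close>
    define f where "f k = (if k \<le> i then (par ^^ k) x else (par ^^ (i + j - k)) y)" for k
    have f_y: "f k = (par ^^ (i + j - k)) y" if "i \<le> k" for k
      using that eq by (auto simp: f_def)
    have neq: "f a \<noteq> f b" if "a < b" "b \<le> i + j" for a b
    proof
      assume fab: "f a = f b"
      \<comment> \<open>Repetitions on one chain are excluded by depth, and one across the two
        chains would be an earlier meeting.\<close>
      consider "b \<le> i" | "i \<le> a" | "a \<le> i" "i < b" by linarith
      then show False
      proof cases
        case 1
        then show False using fab up_inj[of x a b] V i that by (auto simp: f_def)
      next
        case 2
        then have "(par ^^ (i + j - a)) y = (par ^^ (i + j - b)) y"
          using fab that by (simp add: f_y)
        then have "i + j - a = i + j - b"
          using 2 that V j by (intro up_inj[of y]) auto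
        then show False using that by linarith
      next
        case 3
        then have "P (a, i + j - b)" using fab i j that by (auto simp: P_def f_def)
        from least[OF this] 3 that show False by linarith
      qed
    qed
    define vs where "vs = map f [0..<Suc (i + j)]"
    have nth: "vs ! k = f k" if "k \<le> i + j" for k
      using that unfolding vs_def by (subst nth_map) (auto simp del: upt_Suc)
    have len: "length vs = Suc (i + j)" by (simp add: vs_def)
    have f0: "f 0 = x" by (simp add: f_def)
    have fl: "f (i + j) = y" using f_y[of "i + j"] by simp
    have "graph_cycle E vs"
      unfolding graph_cycle_def
    proof (intro conjI allI impI)
      \<comment> \<open>A list of length at most 2 would mean that \<open>x = y\<close> or that one
        end point is the parent of the other.\<close>
      have "i + j \<noteq> 0" using V f0 fl by (intro notI) auto
      moreover have "\<not> (i = 1 \<and> j = 0)"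
      proof
        assume "i = 1 \<and> j = 0"
        then have "x \<noteq> r" "y = par x" using eq i d_r by auto
        then show False using neg by simp
      qed
      moreover have "\<not> (i = 0 \<and> j = 1)"
      proof
        assume "i = 0 \<and> j = 1"
        then have "y \<noteq> r" "x = par y" using eq j d_r by auto
        then show False using neg by simp
      qed
      ultimately show "3 \<le> length vs" using len by linarith
      have "inj_on f {0..<Suc (i + j)}"
        by (rule linorder_inj_onI') (use neq in auto)
      then show "distinct vs" unfolding vs_def by (simp add: distinct_map del: upt_Suc)
      fix k assume k: "k < length vs"
      consider "k < i" | "i \<le> k" "k < i + j" | "k = i + j" using k len by linarith
      then show "{vs ! k, vs ! (Suc k mod length vs)} \<in> E"
      proof cases
        case 1
        then show ?thesis using up_edge[of x k] V i len by (simp add: nth f_def)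
      next
        case 2
        then have "i + j - k = Suc (i + j - Suc k)" by simp
        then show ?thesis using up_edge[of y "i + j - Suc k"] V j len 2
          by (simp add: nth f_y insert_commute)
      next
        case 3
        then show ?thesis using xy len f0 fl by (simp add: nth insert_commute)
      qed
    qed
    then show False using T unfolding tree_graph_def by blast
  qed
  have "E = (\<lambda>x. {x, par x}) ` (V - {r})"
  proof (intro set_eqI iffI)
    fix e assume e: "e \<in> E"
    then obtain x y where "e = {x, y}" "x \<in> V" "y \<in> V"
      using T unfolding tree_graph_def simple_graph_def by blast
    with tree_edge[of x y] e show "e \<in> (\<lambda>x. {x, par x}) ` (V - {r})"
      by (auto simp: insert_commute)
  next
    fix e assume "e \<in> (\<lambda>x. {x, par x}) ` (V - {r})"
    then show "e \<in> E" using par by auto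
  qed
  then have "rooted_tree V E r par d"
    using r d_r par par_in by unfold_locales auto
  then show thesis by (rule that)
qed

section \<open>One step of the walk\<close>

context rwce
begin

section \<open>Measurability with respect to the history\<close>

lemma position_in: "\<omega> \<in> space M \<Longrightarrow> X t \<omega> \<in> V"
  using measurable_space[OF measurable_position] by simp

lemma subalgebra_history: "subalgebra M (history M V E X C t)"
proof -
  have "(\<lambda>\<omega>. \<lambda>s\<in>{..t}. (X s \<omega>, restrict (C s \<omega>) E)) \<in>
      measurable M (\<Pi>\<^sub>M s\<in>{..t}. count_space V \<Otimes>\<^sub>M (\<Pi>\<^sub>M e\<in>E. borel))"
    by (intro measurable_restrict measurable_Pair measurable_position measurable_conductance)
  then show ?thesis
    unfolding subalgebra_def history_def space_vimage_algebra
    using sets_image_in_sets[OF refl] by blast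
qed

lemma sigma_finite_subalgebra_history: "sigma_finite_subalgebra M (history M V E X C t)"
  by (intro finite_measure_subalgebra_is_sigma_finite finite_measure_subalgebra.intro
      finite_measure_subalgebra_axioms.intro subalgebra_history finite_measure_axioms)

lemma sets_history_imp_sets: "A \<in> sets (history M V E X C t) \<Longrightarrow> A \<in> sets M"
  using subalgebra_history unfolding subalgebra_def by blast

lemma space_history: "space (history M V E X C t) = space M"
  using subalgebra_history unfolding subalgebra_def by blast

lemma measurable_history_component:
  assumes "s \<le> t"
  shows "(\<lambda>\<omega>. (X s \<omega>, restrict (C s \<omega>) E)) \<in>
    measurable (history M V E X C t) (count_space V \<Otimes>\<^sub>M (\<Pi>\<^sub>M e\<in>E. borel))"
proof -
  let ?h = "\<lambda>\<omega>. \<lambda>s\<in>{..t}. (X s \<omega>, restrict (C s \<omega>) E)"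
  have "?h \<in> measurable (history M V E X C t)
      (\<Pi>\<^sub>M s\<in>{..t}. count_space V \<Otimes>\<^sub>M (\<Pi>\<^sub>M e\<in>E. borel))"
    unfolding history_def
    by (intro measurable_vimage_algebra1) (auto simp: space_PiM space_pair_measure position_in)
  from measurable_compose[OF this measurable_component_singleton[of s "{..t}"]] assms
  show ?thesis by simp
qed

lemma measurable_history_position:
  "s \<le> t \<Longrightarrow> X s \<in> measurable (history M V E X C t) (count_space V)"
  using measurable_compose[OF measurable_history_component measurable_fst] by simp

lemma measurable_history_conductance:
  assumes "s \<le> t" "e \<in> E"
  shows "(\<lambda>\<omega>. C s \<omega> e) \<in> borel_measurable (history M V E X C t)"
proof -
  have "(\<lambda>z. snd z e) \<in> borel_measurable (count_space V \<Otimes>\<^sub>M (\<Pi>\<^sub>M e\<in>E. borel :: real measure))"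
    by (rule measurable_compose[OF measurable_snd measurable_component_singleton[OF assms(2)]])
  from measurable_compose[OF measurable_history_component[OF assms(1)] this] assms(2)
  show ?thesis by simp
qed

lemma sets_history_position:
  assumes "s \<le> t"
  shows "{\<omega> \<in> space M. P (X s \<omega>)} \<in> sets (history M V E X C t)"
proof -
  have "X s -` {v \<in> V. P v} \<inter> space (history M V E X C t) \<in> sets (history M V E X C t)"
    by (rule measurable_sets[OF measurable_history_position[OF assms]]) auto
  also have "X s -` {v \<in> V. P v} \<inter> space (history M V E X C t) = {\<omega> \<in> space M. P (X s \<omega>)}"
    by (auto simp: space_history position_in)
  finally show ?thesis .
qed

lemma sets_history_conductance:
  assumes "s \<le> t" "e \<in> E"
  shows "{\<omega> \<in> space M. \<delta> \<le> C s \<omega> e} \<in> sets (history M V E X C t)"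
proof -
  note measurable_history_conductance[OF assms, measurable]
  have "{\<omega> \<in> space (history M V E X C t). \<delta> \<le> C s \<omega> e} \<in> sets (history M V E X C t)"
    by measurable
  then show ?thesis by (simp add: space_history)
qed

lemma sets_position: "{\<omega> \<in> space M. P (X s \<omega>)} \<in> sets M"
  using sets_history_position[of s s] sets_history_imp_sets by blast

section \<open>The law of the next position given the history\<close>

text \<open>Potentials will be \<open>ennreal\<close>-valued, and the nonnegative conditional
  expectation can be multiplied by them without integrability conditions. Hence the defining
  property of the walk is transferred to it.\<close>

lemma nn_cond_exp_step:
  assumes v: "v \<in> V"
  shows "AE \<omega> in M. nn_cond_exp M (history M V E X C t)
      (indicator {\<omega> \<in> space M. X (Suc t) \<omega> = v}) \<omega> = ennreal (transition_prob E (C t \<omega>) (X t \<omega>) v)"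
proof -
  let ?F = "history M V E X C t" and ?D = "{\<omega> \<in> space M. X (Suc t) \<omega> = v}"
  let ?q = "real_cond_exp M ?F (indicator ?D)"
  interpret F: sigma_finite_subalgebra M ?F by (rule sigma_finite_subalgebra_history)
  have D: "?D \<in> sets M" by (rule sets_position)
  have int: "integrable M (indicator ?D :: _ \<Rightarrow> real)"
    using D by (intro integrable_const_bound[where B=1]) auto
  have nonneg: "AE \<omega> in M. 0 \<le> ?q \<omega>"
    using D by (intro F.real_cond_exp_pos) auto
  have "AE \<omega> in M. ennreal (?q \<omega>) = nn_cond_exp M ?F (indicator ?D) \<omega>"
  proof (rule F.nn_cond_exp_charact)
    fix A assume A: "A \<in> sets ?F"
    then have AM: "A \<in> sets M" by (rule sets_history_imp_sets)
    have "(\<integral>\<^sup>+\<omega>\<in>A. indicator ?D \<omega> \<partial>M) = ennreal (LINT \<omega>:A|M. indicator ?D \<omega>)"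
      using AM D by (simp add: set_lebesgue_integral_def indicator_inter_arith[symmetric]
          emeasure_eq_measure Int_commute)
    also have "\<dots> = ennreal (LINT \<omega>:A|M. ?q \<omega>)"
      by (simp only: F.real_cond_exp_intA[OF int A])
    also have "\<dots> = (\<integral>\<^sup>+\<omega>. ennreal (indicator A \<omega> * ?q \<omega>) \<partial>M)"
      unfolding set_lebesgue_integral_def real_scaleR_def
      by (rule nn_integral_eq_integral[symmetric])
        (use nonneg integrable_mult_indicator[OF AM F.real_cond_exp_int(1)[OF int]] in auto)
    also have "\<dots> = (\<integral>\<^sup>+\<omega>\<in>A. ennreal (?q \<omega>) \<partial>M)"
      by (intro nn_integral_cong) (auto simp: indicator_def)
    finally show "(\<integral>\<^sup>+\<omega>\<in>A. indicator ?D \<omega> \<partial>M) = (\<integral>\<^sup>+\<omega>\<in>A. ennreal (?q \<omega>) \<partial>M)" .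
  qed (use D in auto)
  with step[OF v, of t] show ?thesis by eventually_elim simp
qed

lemma nn_integral_step:
  assumes "v \<in> V" and f: "f \<in> borel_measurable (history M V E X C t)"
  shows "(\<integral>\<^sup>+\<omega>. f \<omega> * indicator {\<omega> \<in> space M. X (Suc t) \<omega> = v} \<omega> \<partial>M) =
    (\<integral>\<^sup>+\<omega>. f \<omega> * ennreal (transition_prob E (C t \<omega>) (X t \<omega>) v) \<partial>M)"
proof -
  let ?F = "history M V E X C t" and ?D = "{\<omega> \<in> space M. X (Suc t) \<omega> = v}"
  interpret F: sigma_finite_subalgebra M ?F by (rule sigma_finite_subalgebra_history)
  have "(\<integral>\<^sup>+\<omega>. f \<omega> * indicator ?D \<omega> \<partial>M) = (\<integral>\<^sup>+\<omega>. f \<omega> * nn_cond_exp M ?F (indicator ?D) \<omega> \<partial>M)"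
    using sets_position by (intro F.nn_cond_exp_intg[symmetric] f) auto
  also have "\<dots> = (\<integral>\<^sup>+\<omega>. f \<omega> * ennreal (transition_prob E (C t \<omega>) (X t \<omega>) v) \<partial>M)"
    by (rule nn_integral_cong_AE) (use nn_cond_exp_step[OF assms(1), of t] in auto)
  finally show ?thesis .
qed

text \<open>Split according to the countably many values of the next position and exchange sum and
  integral. The function \<open>f v\<close> may itself depend on the history, as a potential built
  from \<open>C t\<close> does.\<close>

lemma nn_integral_next_position:
  assumes V: "countable V"
    and f: "\<And>v. v \<in> V \<Longrightarrow> f v \<in> borel_measurable (history M V E X C t)"
  shows "(\<integral>\<^sup>+\<omega>. f (X (Suc t) \<omega>) \<omega> \<partial>M) =
    (\<integral>\<^sup>+\<omega>. \<integral>\<^sup>+v. ennreal (transition_prob E (C t \<omega>) (X t \<omega>) v) * f v \<omega> \<partial>count_space V \<partial>M)"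
proof -
  let ?F = "history M V E X C t" and ?D = "\<lambda>v. {\<omega> \<in> space M. X (Suc t) \<omega> = v}"
  \<comment> \<open>\<open>q v\<close> is measurable by construction and almost surely equal to the
    transition probability, whose own measurability then need not be checked.\<close>
  define q where "q v = nn_cond_exp M ?F (indicator (?D v))" for v
  have q: "AE \<omega> in M. \<forall>v\<in>V. q v \<omega> = ennreal (transition_prob E (C t \<omega>) (X t \<omega>) v)"
    unfolding q_def by (rule AE_ball_countable'[OF nn_cond_exp_step V])
  have fM: "f v \<in> borel_measurable M" if "v \<in> V" for v
    using f[OF that] subalgebra_history by (rule measurable_from_subalg[rotated])
  have qM: "q v \<in> borel_measurable M" for v
    unfolding q_def by (rule borel_measurable_nn_cond_exp2)
  have "(\<integral>\<^sup>+\<omega>. f (X (Suc t) \<omega>) \<omega> \<partial>M) =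
      (\<integral>\<^sup>+\<omega>. \<integral>\<^sup>+v. f v \<omega> * indicator (?D v) \<omega> \<partial>count_space V \<partial>M)"
  proof (rule nn_integral_cong)
    fix \<omega> assume \<omega>: "\<omega> \<in> space M"
    have "(\<integral>\<^sup>+v. f v \<omega> * indicator (?D v) \<omega> \<partial>count_space V) =
        (\<Sum>v\<in>{X (Suc t) \<omega>}. f v \<omega> * indicator (?D v) \<omega>)"
      using \<omega> by (intro nn_integral_count_space') (auto simp: position_in)
    then show "f (X (Suc t) \<omega>) \<omega> = (\<integral>\<^sup>+v. f v \<omega> * indicator (?D v) \<omega> \<partial>count_space V)"
      using \<omega> by simp
  qed
  also have "\<dots> = (\<integral>\<^sup>+v. \<integral>\<^sup>+\<omega>. f v \<omega> * indicator (?D v) \<omega> \<partial>M \<partial>count_space V)"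
    using fM
    by (intro nn_integral_count_space_nn_integral V borel_measurable_times_ennreal
        borel_measurable_indicator sets_position)
  also have "\<dots> = (\<integral>\<^sup>+v. \<integral>\<^sup>+\<omega>. f v \<omega> * q v \<omega> \<partial>M \<partial>count_space V)"
  proof (rule nn_integral_cong)
    fix v assume "v \<in> space (count_space V)"
    then have v: "v \<in> V" by simp
    show "(\<integral>\<^sup>+\<omega>. f v \<omega> * indicator (?D v) \<omega> \<partial>M) = (\<integral>\<^sup>+\<omega>. f v \<omega> * q v \<omega> \<partial>M)"
      unfolding nn_integral_step[OF v f[OF v]]
      by (rule nn_integral_cong_AE) (use q v in auto)
  qed
  also have "\<dots> = (\<integral>\<^sup>+\<omega>. \<integral>\<^sup>+v. f v \<omega> * q v \<omega> \<partial>count_space V \<partial>M)"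
    using fM qM by (intro nn_integral_count_space_nn_integral[symmetric] V borel_measurable_times_ennreal)
  also have "\<dots> = (\<integral>\<^sup>+\<omega>. \<integral>\<^sup>+v. ennreal (transition_prob E (C t \<omega>) (X t \<omega>) v) * f v \<omega>
      \<partial>count_space V \<partial>M)"
    by (rule nn_integral_cong_AE, use q in eventually_elim)
      (auto intro!: nn_integral_cong simp: mult.commute)
  finally show ?thesis .
qed

lemma prob_step_ge:
  assumes v: "v \<in> V" and A: "A \<in> sets (history M V E X C t)" and \<eta>: "0 \<le> \<eta>"
    and le: "AE \<omega> in M. \<omega> \<in> A \<longrightarrow> \<eta> \<le> transition_prob E (C t \<omega>) (X t \<omega>) v"
  shows "\<eta> * prob A \<le> prob (A \<inter> {\<omega> \<in> space M. X (Suc t) \<omega> = v})"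
proof -
  let ?D = "{\<omega> \<in> space M. X (Suc t) \<omega> = v}"
  have AM: "A \<in> sets M" using A by (rule sets_history_imp_sets)
  have "ennreal (\<eta> * prob A) = (\<integral>\<^sup>+\<omega>. ennreal \<eta> * indicator A \<omega> \<partial>M)"
    using AM \<eta> by (simp add: nn_integral_cmult_indicator emeasure_eq_measure ennreal_mult)
  also have "\<dots> \<le> (\<integral>\<^sup>+\<omega>. indicator A \<omega> * ennreal (transition_prob E (C t \<omega>) (X t \<omega>) v) \<partial>M)"
    by (rule nn_integral_mono_AE, use le in eventually_elim)
      (auto simp: indicator_def intro: ennreal_leI)
  also have "\<dots> = (\<integral>\<^sup>+\<omega>. indicator A \<omega> * indicator ?D \<omega> \<partial>M)"
    using A by (intro nn_integral_step[symmetric] v) auto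
  also have "\<dots> = ennreal (prob (A \<inter> ?D))"
    using AM sets_position[of "\<lambda>x. x = v" "Suc t"]
    by (simp add: indicator_inter_arith[symmetric] emeasure_eq_measure)
  finally show ?thesis by simp
qed

section \<open>Infinitely many visits spread along edges\<close>

text \<open>The events \<open>D t\<close> (the walk is at \<open>x\<close> at time \<open>t\<close> and has avoided \<open>y\<close> since time \<open>s\<close>) have
  summable probabilities: each carries a fixed proportion of mass to \<open>y\<close> at time \<open>t + 1\<close>, and
  the events of first arrival at \<open>y\<close> are disjoint.\<close>

lemma AE_infinite_visits_neighbour:
  assumes xy: "{x, y} \<in> E" "x \<in> V" "y \<in> V" "x \<noteq> y"
    and incr: "AE \<omega> in M. \<forall>s t. s \<le> t \<longrightarrow> C s \<omega> {x, y} \<le> C t \<omega> {x, y}"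
    and pos: "AE \<omega> in M. \<forall>t. 0 < C t \<omega> {x, y}"
    and bound: "AE \<omega> in M. \<forall>t. 0 < total_conductance E (C t \<omega>) x \<and> total_conductance E (C t \<omega>) x \<le> B"
    and B: "0 < B"
  shows "AE \<omega> in M. infinite {t. X t \<omega> = x} \<longrightarrow> infinite {t. X t \<omega> = y}"
proof -
  \<comment> \<open>The conductance of the edge at time \<open>s\<close> is positive but has no
    deterministic lower bound; countably many thresholds cover all cases.\<close>
  define \<delta> where "\<delta> k = 1 / real (Suc k)" for k
  have \<delta>: "0 < \<delta> k" for k by (simp add: \<delta>_def)
  define D where "D s k t = {\<omega> \<in> space M. s \<le> t \<and> \<delta> k \<le> C s \<omega> {x, y} \<and>
      (\<forall>r\<in>{s..t}. X r \<omega> \<noteq> y) \<and> X t \<omega> = x}" for s k t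
  have D_meas: "D s k t \<in> sets (history M V E X C t)" for s k t
  proof (cases "s \<le> t")
    case True
    have "D s k t = {\<omega> \<in> space M. \<delta> k \<le> C s \<omega> {x, y}} \<inter>
        (\<Inter>r\<in>{s..t}. {\<omega> \<in> space M. X r \<omega> \<noteq> y}) \<inter> {\<omega> \<in> space M. X t \<omega> = x}"
      using True by (auto simp: D_def)
    also have "\<dots> \<in> sets (history M V E X C t)"
      using True xy by (intro sets.Int sets.finite_INT
          sets_history_conductance sets_history_position) auto
    finally show ?thesis .
  qed (simp add: D_def)
  have "AE \<omega> in M. eventually (\<lambda>t. \<omega> \<in> space M - D s k t) sequentially" for s k
  proof (rule borel_cantelli_AE1)
    show DM: "D s k t \<in> sets M" for t using D_meas by (rule sets_history_imp_sets)
    define G where "G t = D s k t \<inter> {\<omega> \<in> space M. X (Suc t) \<omega> = y}" for t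
    have GM: "G t \<in> sets M" for t unfolding G_def by (intro sets.Int DM sets_position)
    have disj: "disjoint_family_on G A" for A
    proof -
      have "G t \<inter> G t' = {}" if "t < t'" for t t'
        using that by (auto simp: G_def D_def)
      then show ?thesis unfolding disjoint_family_on_def by (metis inf_commute linorder_neqE_nat)
    qed
    \<comment> \<open>From \<open>x\<close> the walk moves to \<open>y\<close> with at least this
      probability: the edge still has conductance at least \<open>\<delta> k\<close> by
      monotonicity, and the total at \<open>x\<close> is at most \<open>B\<close>.\<close>
    define \<eta> where "\<eta> = \<delta> k / B"
    have \<eta>: "0 < \<eta>" using \<delta> B by (simp add: \<eta>_def)
    have le: "\<eta> * prob (D s k t) \<le> prob (G t)" for t
      unfolding G_def
    proof (rule prob_step_ge[OF xy(3) D_meas])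
      show "AE \<omega> in M. \<omega> \<in> D s k t \<longrightarrow> \<eta> \<le> transition_prob E (C t \<omega>) (X t \<omega>) y"
        using incr bound
      proof eventually_elim
        fix \<omega> assume *: "\<forall>s t. s \<le> t \<longrightarrow> C s \<omega> {x, y} \<le> C t \<omega> {x, y}"
          "\<forall>t. 0 < total_conductance E (C t \<omega>) x \<and> total_conductance E (C t \<omega>) x \<le> B"
        show "\<omega> \<in> D s k t \<longrightarrow> \<eta> \<le> transition_prob E (C t \<omega>) (X t \<omega>) y"
        proof
          assume "\<omega> \<in> D s k t"
          then have "s \<le> t" "\<delta> k \<le> C s \<omega> {x, y}" "X t \<omega> = x" by (auto simp: D_def)
          moreover from this *(1) have "\<delta> k \<le> C t \<omega> {x, y}" by (meson order_trans)
          ultimately show "\<eta> \<le> transition_prob E (C t \<omega>) (X t \<omega>) y"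
            unfolding \<eta>_def transition_prob_def using *(2) xy(1) \<delta>[of k]
            by (auto intro!: frac_le)
        qed
      qed
    qed (use \<eta> in simp)
    show "summable (\<lambda>t. prob (D s k t))"
    proof (rule summableI_nonneg_bounded[where x="1 / \<eta>"])
      fix n
      have "\<eta> * (\<Sum>t<n. prob (D s k t)) \<le> (\<Sum>t<n. prob (G t))"
        unfolding sum_distrib_left by (intro sum_mono le)
      also have "\<dots> = prob (\<Union>t<n. G t)"
        using GM disj by (intro finite_measure_finite_Union[symmetric]) auto
      also have "\<dots> \<le> 1" by simp
      finally show "(\<Sum>t<n. prob (D s k t)) \<le> 1 / \<eta>" using \<eta> by (simp add: field_simps)
    qed simp
  qed (simp add: emeasure_eq_measure)
  then have "AE \<omega> in M. \<forall>s k. eventually (\<lambda>t. \<omega> \<in> space M - D s k t) sequentially"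
    by (simp add: AE_all_countable)
  with pos AE_space show ?thesis
  proof eventually_elim
    fix \<omega> assume pos: "\<forall>t. 0 < C t \<omega> {x, y}" and \<omega>: "\<omega> \<in> space M"
      and ev: "\<forall>s k. eventually (\<lambda>t. \<omega> \<in> space M - D s k t) sequentially"
    show "infinite {t. X t \<omega> = x} \<longrightarrow> infinite {t. X t \<omega> = y}"
    proof (rule impI, rule ccontr)
      assume inf: "infinite {t. X t \<omega> = x}" and "\<not> infinite {t. X t \<omega> = y}"
      then obtain s where s: "\<And>r. s \<le> r \<Longrightarrow> X r \<omega> \<noteq> y"
        unfolding infinite_nat_iff_unbounded_le by auto
      obtain k where "\<delta> k < C s \<omega> {x, y}"
        using pos[rule_format, of s] reals_Archimedean[of "C s \<omega> {x, y}"]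
        by (auto simp: \<delta>_def inverse_eq_divide)
      moreover obtain T where T: "\<And>t. T \<le> t \<Longrightarrow> \<omega> \<notin> D s k t"
        using ev unfolding eventually_sequentially by blast
      ultimately have "X t \<omega> \<noteq> x" if "max s T \<le> t" for t
        using s \<omega> T[of t] that unfolding D_def by auto
      with inf show False unfolding infinite_nat_iff_unbounded_le by blast
    qed
  qed
qed

end

section \<open>Averaging operator and recurrence of a fixed weighted graph\<close>

text \<open>The Markov operator of the weighted walk; \<open>walk_op V E c g x \<le> g x\<close> is
  superharmonicity at \<open>x\<close>.\<close>

definition walk_op :: "'v set \<Rightarrow> 'v set set \<Rightarrow> ('v set \<Rightarrow> real) \<Rightarrow> ('v \<Rightarrow> ennreal) \<Rightarrow> 'v \<Rightarrow> ennreal" where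
  "walk_op V E c g x = (\<integral>\<^sup>+v. ennreal (transition_prob E c x v) * g v \<partial>count_space V)"

lemma total_conductance_pos:
  assumes c: "conductance V E c" and pos: "\<And>e. e \<in> E \<Longrightarrow> 0 < c e"
    and xy: "{x, y} \<in> E" "x \<in> V"
  shows "0 < total_conductance E c x"
proof -
  have "0 < sum c {{x, y}}" using pos xy by simp
  also have "\<dots> \<le> total_conductance E c x"
    unfolding total_conductance_def
    using c xy by (intro finite_sum_le_infsum) (auto simp: conductance_def)
  finally show ?thesis .
qed

lemma nn_integral_transition_prob:
  assumes "simple_graph V E" and c: "conductance V E c" and "x \<in> V"
    and "0 < total_conductance E c x"
  shows "(\<integral>\<^sup>+v. ennreal (transition_prob E c x v) \<partial>count_space V) = 1"
proof -
  let ?p = "transition_prob E c x"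
  have sum: "(?p has_sum 1) V" by (rule transition_prob_has_sum[OF assms])
  have nonneg: "0 \<le> ?p v" for v by (rule transition_prob_nonneg[OF c \<open>x \<in> V\<close>])
  have "(\<lambda>v. norm (?p v)) summable_on V"
    using sum nonneg by (simp add: has_sum_imp_summable)
  then have "Infinite_Set_Sum.abs_summable_on ?p V"
    by (simp add: abs_summable_equivalent[symmetric])
  then show ?thesis
    using nonneg sum by (simp add: nn_integral_conv_infsetsum infsetsum_infsum infsumI)
qed

lemma walk_op_mono: "(\<And>v. v \<in> V \<Longrightarrow> f v \<le> g v) \<Longrightarrow> walk_op V E c f x \<le> walk_op V E c g x"
  unfolding walk_op_def by (intro nn_integral_mono mult_left_mono) auto

lemma walk_op_const:
  assumes "simple_graph V E" "conductance V E c" "x \<in> V" "0 < total_conductance E c x"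
  shows "walk_op V E c (\<lambda>_. a) x = a"
  unfolding walk_op_def
  by (subst nn_integral_multc) (simp_all add: nn_integral_transition_prob[OF assms])

text \<open>A bounded function that is subharmonic off \<open>r\<close> and vanishes at \<open>r\<close> is a submartingale along
  the walk stopped at \<open>r\<close>, so it is bounded by the probability of not having hit \<open>r\<close> yet.\<close>

lemma recurrent_graph_subharmonic_zero:
  assumes G: "simple_graph V E" and rec: "recurrent_graph V E c" and V: "countable V"
    and pos: "\<And>u. u \<in> V \<Longrightarrow> 0 < total_conductance E c u"
    and g: "g r = 0" "\<And>v. g v \<le> 1" "\<And>v. v \<in> V \<Longrightarrow> v \<noteq> r \<Longrightarrow> g v \<le> walk_op V E c g v"
    and r: "r \<in> V" and x: "x \<in> V"
  shows "g x = 0"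
proof -
  have c: "conductance V E c" using rec by (simp add: recurrent_graph_def)
  obtain M :: "(nat \<Rightarrow> 'a) measure" and X where "rwce M V E X (\<lambda>t \<omega>. c)"
    and X0: "AE \<omega> in M. X 0 \<omega> = x"
    using weighted_walk_exists[OF G c pos x] by blast
  then interpret rwce M V E X "\<lambda>t \<omega>. c" by simp
  have "recurrent_walk M V X"
    using rec rwce_axioms unfolding recurrent_graph_def by blast
  then have hit: "AE \<omega> in M. infinite {t. X t \<omega> = r}"
    unfolding recurrent_walk_def by eventually_elim (use r in blast)
  define A where "A t = {\<omega> \<in> space M. \<forall>s\<in>{..t}. X s \<omega> \<noteq> r}" for t
  have A_hist: "A t \<in> sets (history M V E X (\<lambda>t \<omega>. c) t)" for t
  proof -
    have "A t = (\<Inter>s\<in>{..t}. {\<omega> \<in> space M. X s \<omega> \<noteq> r})" by (auto simp: A_def)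
    also have "\<dots> \<in> sets (history M V E X (\<lambda>t \<omega>. c) t)"
      by (intro sets.finite_INT sets_history_position) auto
    finally show ?thesis .
  qed
  then have A: "A t \<in> sets M" for t by (rule sets_history_imp_sets)
  \<comment> \<open>The mean of \<open>g\<close> along the walk killed at its first visit to
    \<open>r\<close>.\<close>
  define e where "e t = (\<integral>\<^sup>+\<omega>. indicator (A t) \<omega> * g (X t \<omega>) \<partial>M)" for t
  have step: "e t \<le> e (Suc t)" for t
  proof -
    have "e t \<le> (\<integral>\<^sup>+\<omega>. \<integral>\<^sup>+v. ennreal (transition_prob E c (X t \<omega>) v) *
        (indicator (A t) \<omega> * g v) \<partial>count_space V \<partial>M)"
      unfolding e_def
    proof (rule nn_integral_mono)
      fix \<omega> assume \<omega>: "\<omega> \<in> space M"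
      show "indicator (A t) \<omega> * g (X t \<omega>) \<le> (\<integral>\<^sup>+v. ennreal (transition_prob E c (X t \<omega>) v) *
        (indicator (A t) \<omega> * g v) \<partial>count_space V)"
      proof (cases "\<omega> \<in> A t")
        case True
        then show ?thesis
          using g(3)[OF position_in[OF \<omega>], of t] by (simp add: A_def walk_op_def)
      qed simp
    qed
    also have "\<dots> = (\<integral>\<^sup>+\<omega>. indicator (A t) \<omega> * g (X (Suc t) \<omega>) \<partial>M)"
      using A_hist by (intro nn_integral_next_position[symmetric] V) auto
    \<comment> \<open>The paths lost between \<open>A t\<close> and \<open>A (Suc t)\<close> are at
      \<open>r\<close> at time \<open>t + 1\<close>, where \<open>g\<close> vanishes.\<close>
    also have "\<dots> \<le> e (Suc t)"
      unfolding e_def using g(1)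
      by (intro nn_integral_mono) (auto simp: A_def le_Suc_eq split: split_indicator)
    finally show ?thesis .
  qed
  have "g x = (\<integral>\<^sup>+\<omega>. g x \<partial>M)" by (simp add: emeasure_space_1)
  also have "\<dots> = e 0"
    unfolding e_def
    by (rule nn_integral_cong_AE, use X0 AE_space in eventually_elim)
      (auto simp: A_def g(1) split: split_indicator)
  finally have g0: "g x = e 0" .
  have "g x \<le> emeasure M (A t)" for t
  proof -
    have "g x \<le> e t" unfolding g0 by (rule lift_Suc_mono_le[of e, OF step]) simp
    also have "\<dots> \<le> (\<integral>\<^sup>+\<omega>. indicator (A t) \<omega> \<partial>M)"
      unfolding e_def
      using g(2) by (intro nn_integral_mono) (auto split: split_indicator)
    finally show ?thesis using A by simp
  qed
  \<comment> \<open>The events \<open>A t\<close> decrease to the event of never visiting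
    \<open>r\<close>, which is null by recurrence.\<close>
  moreover have "(\<lambda>t. emeasure M (A t)) \<longlonglongrightarrow> emeasure M (\<Inter>t. A t)"
    using A by (intro Lim_emeasure_decseq) (auto simp: A_def decseq_def emeasure_eq_measure)
  moreover have "emeasure M (\<Inter>t. A t) = 0"
  proof -
    have "AE \<omega> in M. \<omega> \<notin> (\<Inter>t. A t)"
      using hit
    proof eventually_elim
      fix \<omega> assume "infinite {t. X t \<omega> = r}"
      then obtain t where "X t \<omega> = r" using not_finite_existsD by fastforce
      then show "\<omega> \<notin> (\<Inter>t. A t)" by (auto simp: A_def)
    qed
    then show ?thesis using A by (subst (asm) AE_iff_null_sets[symmetric]) auto
  qed
  ultimately have "g x \<le> 0"
    by (intro Lim_bounded2[of _ 0]) auto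
  then show ?thesis by simp
qed

section \<open>Potentials of flows on rooted trees\<close>

context rooted_tree
begin

abbreviation edge :: "'v \<Rightarrow> 'v set" where
  "edge x \<equiv> {x, par x}"

definition children :: "'v \<Rightarrow> 'v set" where
  "children x = {y \<in> V - {root}. par y = x}"

lemma par_neq: "x \<in> V \<Longrightarrow> x \<noteq> root \<Longrightarrow> par x \<noteq> x"
  using depth_par by fastforce

lemma edge_in: "x \<in> V \<Longrightarrow> x \<noteq> root \<Longrightarrow> edge x \<in> E"
  using edges by blast

lemma simple_graph: "simple_graph V E"
  unfolding simple_graph_def edges using par_in par_neq by blast

lemma edge_iff:
  "{x, y} \<in> E \<longleftrightarrow> x \<in> V \<and> x \<noteq> root \<and> y = par x \<or> y \<in> children x"
  unfolding edges children_def by (auto simp: doubleton_eq_iff image_iff)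

lemma edge_memD: "{x, y} \<in> E \<Longrightarrow> x \<in> V \<and> y \<in> V \<and> x \<noteq> y"
  using simple_graph unfolding simple_graph_def by (fastforce simp: doubleton_eq_iff)

lemma par_notin_children: "x \<in> V \<Longrightarrow> x \<noteq> root \<Longrightarrow> par x \<notin> children x"
  using depth_par[of x] depth_par[of "par x"] by (auto simp: children_def)

lemma ancestor:
  assumes "x \<in> V"
  shows "i < depth x \<Longrightarrow> (par ^^ i) x \<in> V \<and> (par ^^ i) x \<noteq> root \<and> depth ((par ^^ i) x) = depth x - i"
proof (induction i)
  case 0
  then show ?case using assms depth_root by auto
next
  case (Suc i)
  let ?y = "(par ^^ i) x"
  have y: "?y \<in> V" "?y \<noteq> root" "depth ?y = depth x - i" using Suc by auto
  then have "depth (par ?y) = depth x - Suc i" using depth_par[of ?y] by simp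
  then show ?case using y Suc.prems par_in depth_root by auto
qed

lemma root_if_depth_0: "x \<in> V \<Longrightarrow> depth x = 0 \<Longrightarrow> x = root"
  using depth_par by fastforce

lemma rooted_induct [consumes 1, case_names root step]:
  assumes "x \<in> V" and "P root"
    and "\<And>x. x \<in> V \<Longrightarrow> x \<noteq> root \<Longrightarrow> P (par x) \<Longrightarrow> P x"
  shows "P x"
  using assms(1)
proof (induction "depth x" arbitrary: x)
  case 0
  then show ?case using root_if_depth_0 assms(2) by simp
next
  case (Suc n)
  then have x: "x \<noteq> root" using depth_root by auto
  then have "P (par x)" using Suc depth_par par_in by auto
  then show ?case using Suc.prems x assms(3) by blast
qed

lemma neighbour_ex:
  assumes "V \<noteq> {root}" "x \<in> V"
  shows "\<exists>y. {x, y} \<in> E"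
proof (cases "x = root")
  case True
  obtain z where z: "z \<in> V" "z \<noteq> root" using assms by blast
  let ?y = "(par ^^ (depth z - 1)) z"
  have d: "0 < depth z" using z root_if_depth_0 by auto
  then have y: "?y \<in> V" "?y \<noteq> root" "depth ?y = 1" using ancestor[OF z(1), of "depth z - 1"] by auto
  then have "par ?y = root" using depth_par[of ?y] par_in root_if_depth_0 by auto
  then have "{root, ?y} \<in> E" using edge_in[OF y(1,2)] by (simp add: insert_commute)
  then show ?thesis using True by blast
qed (use edge_in assms in blast)

text \<open>The tree need not be locally finite, but a summable family has only countably many
  nonzero terms. So each vertex has countably many children, and the depth levels are countable by
  induction.\<close>

lemma countable_vertices:
  assumes c: "conductance V E c" and pos: "\<And>e. e \<in> E \<Longrightarrow> 0 < c e"
  shows "countable V"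
proof -
  have children: "countable (children x)" if "x \<in> V" for x
  proof -
    have "c summable_on {e \<in> E. x \<in> e}" using c that by (simp add: conductance_def)
    from summable_countable_real[OF this] have "countable {e \<in> {e \<in> E. x \<in> e}. c e \<noteq> 0}" .
    moreover have "edge ` children x \<subseteq> {e \<in> {e \<in> E. x \<in> e}. c e \<noteq> 0}"
      using edge_in pos by (fastforce simp: children_def)
    ultimately have "countable (edge ` children x)" by (rule countable_subset[rotated])
    moreover have "inj_on edge (children x)"
      using par_neq by (auto simp: inj_on_def children_def doubleton_eq_iff)
    ultimately show ?thesis by (rule countable_image_inj_on)
  qed
  have "countable {x \<in> V. depth x = n}" for n
  proof (induction n)
    case 0
    have "{x \<in> V. depth x = 0} \<subseteq> {root}" using root_if_depth_0 by auto
    then show ?case by (rule countable_subset) simp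
  next
    case (Suc n)
    have "{x \<in> V. depth x = Suc n} \<subseteq> (\<Union>x\<in>{x \<in> V. depth x = n}. children x)"
      using depth_par par_in depth_root by (fastforce simp: children_def)
    then show ?case using Suc children by (rule countable_subset[OF _ countable_UN]) auto
  qed
  then have "countable (\<Union>n. {x \<in> V. depth x = n})" by simp
  moreover have "(\<Union>n. {x \<in> V. depth x = n}) = V" by auto
  ultimately show ?thesis by simp
qed

lemma nn_integral_neighbours:
  assumes x: "x \<in> V" "x \<noteq> root"
  shows "(\<integral>\<^sup>+v. ennreal (if {x, v} \<in> E then c {x, v} else 0) * f v \<partial>count_space V) =
    ennreal (c (edge x)) * f (par x) + (\<integral>\<^sup>+y. ennreal (c (edge y)) * f y \<partial>count_space (children x))"
    (is "(\<integral>\<^sup>+v. ?h v \<partial>count_space V) = _")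
proof -
  have "(\<integral>\<^sup>+v. ?h v \<partial>count_space V) = (\<integral>\<^sup>+v. ?h v \<partial>count_space ({par x} \<union> children x))"
    using x par_in by (intro nn_integral_count_space_eq) (auto simp: edge_iff children_def)
  also have "\<dots> = (\<integral>\<^sup>+v\<in>{par x} \<union> children x. ?h v \<partial>count_space UNIV)"
    by (subst nn_integral_count_space_indicator) simp_all
  also have "\<dots> = (\<integral>\<^sup>+v\<in>{par x}. ?h v \<partial>count_space UNIV) + (\<integral>\<^sup>+v\<in>children x. ?h v \<partial>count_space UNIV)"
    using par_notin_children[OF x] by (intro nn_integral_disjoint_pair_countspace) auto
  also have "(\<integral>\<^sup>+v\<in>{par x}. ?h v \<partial>count_space UNIV) = (\<integral>\<^sup>+v. ?h v \<partial>count_space {par x})"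
    by (subst nn_integral_count_space_indicator) simp_all
  also have "\<dots> = ennreal (c (edge x)) * f (par x)"
    using x by (simp add: nn_integral_count_space_finite edge_iff)
  also have "(\<integral>\<^sup>+v\<in>children x. ?h v \<partial>count_space UNIV) = (\<integral>\<^sup>+v. ?h v \<partial>count_space (children x))"
    by (subst nn_integral_count_space_indicator) simp_all
  also have "\<dots> = (\<integral>\<^sup>+y. ennreal (c (edge y)) * f y \<partial>count_space (children x))"
    by (rule nn_integral_cong) (auto simp: edge_iff insert_commute, auto simp: children_def insert_commute)
  finally show ?thesis .
qed

text \<open>For a function increasing away from the root, superharmonicity at \<open>x\<close> says that the flow
  \<open>c(e) dg(e)\<close> leaving \<open>x\<close> does not exceed the flow entering it.\<close>

lemma walk_op_le_iff_flow:
  assumes c: "conductance V E c" and pos: "\<And>e. e \<in> E \<Longrightarrow> 0 < c e"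
    and x: "x \<in> V" "x \<noteq> root"
    and mono: "\<And>y. y \<in> V \<Longrightarrow> y \<noteq> root \<Longrightarrow> g (par y) \<le> g y"
    and fin: "\<And>y. y \<in> V \<Longrightarrow> g y \<noteq> \<top>"
  shows "walk_op V E c g x \<le> g x \<longleftrightarrow>
    (\<integral>\<^sup>+y. ennreal (c (edge y)) * (g y - g (par y)) \<partial>count_space (children x))
      \<le> ennreal (c (edge x)) * (g x - g (par x))"
proof -
  let ?\<pi> = "total_conductance E c x"
  let ?a = "\<lambda>v. ennreal (if {x, v} \<in> E then c {x, v} else 0)"
  have \<pi>: "0 < ?\<pi>" using total_conductance_pos[OF c pos edge_in[OF x] x(1)] by simp
  have a: "ennreal ?\<pi> * ennreal (transition_prob E c x v) = ?a v" for v
    using \<pi> pos by (auto simp: transition_prob_def ennreal_mult[symmetric] less_imp_le)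
  \<comment> \<open>Multiplying by the total conductance clears the denominator of the transition
    probabilities.\<close>
  have op: "ennreal ?\<pi> * walk_op V E c f x = (\<integral>\<^sup>+v. ?a v * f v \<partial>count_space V)" for f
    unfolding walk_op_def
    by (subst nn_integral_cmult[symmetric]) (simp_all add: a mult.assoc[symmetric])
  let ?cx = "ennreal (c (edge x))" and ?c = "\<lambda>y. ennreal (c (edge y))"
  let ?K = "\<integral>\<^sup>+y. ?c y \<partial>count_space (children x)"
  let ?D = "\<lambda>y. g y - g (par y)"
  have total: "ennreal ?\<pi> = ?cx + ?K"
    using op[of "\<lambda>_. 1"] nn_integral_neighbours[OF x, of c "\<lambda>_. 1"]
      walk_op_const[OF simple_graph c x(1) \<pi>, of 1] by simp
  then have "?cx + ?K \<noteq> \<top>" by (metis ennreal_neq_top)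
  \<comment> \<open>After the multiplication both sides of the inequality contain this summand, and
    cancelling it in \<open>ennreal\<close> requires that it be finite.\<close>
  then have fin_rest: "?cx * g (par x) + ?K * g x \<noteq> \<top>"
    using fin[OF x(1)] fin[OF par_in[OF x]] by (simp add: ennreal_mult_eq_top_iff)
  have gD: "g (par y) + ?D y = g y" if "y \<in> V" "y \<noteq> root" for y
    using mono[OF that] by (simp add: add_diff_inverse_ennreal)
  have "ennreal ?\<pi> * walk_op V E c g x = ?cx * g (par x) + (\<integral>\<^sup>+y. ?c y * g y \<partial>count_space (children x))"
    unfolding op by (rule nn_integral_neighbours[OF x])
  also have "(\<integral>\<^sup>+y. ?c y * g y \<partial>count_space (children x)) =
      (\<integral>\<^sup>+y. ?c y * g x + ?c y * ?D y \<partial>count_space (children x))"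
  proof (rule nn_integral_cong)
    fix y assume "y \<in> space (count_space (children x))"
    then have "y \<in> V" "y \<noteq> root" "par y = x" by (auto simp: children_def)
    then have "g y = g x + ?D y" using gD[of y] by metis
    then show "?c y * g y = ?c y * g x + ?c y * ?D y" by (metis distrib_left)
  qed
  also have "\<dots> = ?K * g x + (\<integral>\<^sup>+y. ?c y * ?D y \<partial>count_space (children x))"
    by (simp add: nn_integral_add nn_integral_multc)
  finally have 1: "ennreal ?\<pi> * walk_op V E c g x =
      (?cx * g (par x) + ?K * g x) + (\<integral>\<^sup>+y. ?c y * ?D y \<partial>count_space (children x))"
    by (simp add: add.assoc)
  have "ennreal ?\<pi> * g x = ?cx * (g (par x) + ?D x) + ?K * g x"
    unfolding total gD[OF x] by (simp add: distrib_right)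
  then have 2: "ennreal ?\<pi> * g x = (?cx * g (par x) + ?K * g x) + ?cx * ?D x"
    by (simp add: distrib_left ac_simps)
  have "walk_op V E c g x \<le> g x \<longleftrightarrow> ennreal ?\<pi> * walk_op V E c g x \<le> ennreal ?\<pi> * g x"
    using \<pi> by (subst ennreal_mult_le_mult_iff) auto
  then show ?thesis
    unfolding 1 2 ennreal_add_left_cancel_le using fin_rest by simp
qed

section \<open>Voltages generated by a flow\<close>

text \<open>Ohm's law: the voltage at \<open>x\<close>, relative to the root, when the flow
  \<open>\<theta> y\<close> crosses the edge above \<open>y\<close> and edges have resistance
  \<open>1 / a\<close>.\<close>

definition potential :: "('v \<Rightarrow> ennreal) \<Rightarrow> ('v set \<Rightarrow> real) \<Rightarrow> 'v \<Rightarrow> ennreal" where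
  "potential \<theta> a x = (\<Sum>i<depth x. \<theta> ((par ^^ i) x) / ennreal (a (edge ((par ^^ i) x))))"

lemma potential_root: "potential \<theta> a root = 0"
  by (simp add: potential_def depth_root)

lemma potential_par:
  assumes "x \<in> V" "x \<noteq> root"
  shows "potential \<theta> a x = potential \<theta> a (par x) + \<theta> x / ennreal (a (edge x))"
  unfolding potential_def depth_par[OF assms]
  by (subst sum.lessThan_Suc_shift) (simp add: funpow_swap1 add.commute)

text \<open>For a fixed flow, a larger conductance on an edge means a smaller voltage drop across
  it.\<close>

lemma potential_antimono:
  assumes "x \<in> V" and ab: "\<And>e. e \<in> E \<Longrightarrow> 0 < a e \<and> a e \<le> b e"
  shows "potential \<theta> b x \<le> potential \<theta> a x"
proof -
  have "\<theta> y / ennreal (b (edge y)) \<le> \<theta> y / ennreal (a (edge y))" if "y \<in> V" "y \<noteq> root" for y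
  proof -
    have "inverse (ennreal (b (edge y))) \<le> inverse (ennreal (a (edge y)))"
      using ab[OF edge_in[OF that]] by (simp add: inverse_ennreal ennreal_leI le_imp_inverse_le)
    then show ?thesis by (simp add: divide_ennreal_def mult_left_mono)
  qed
  then show ?thesis unfolding potential_def using ancestor[OF assms(1)] by (intro sum_mono) auto
qed

text \<open>Conductance times voltage drop gives back \<open>\<theta>\<close>, whatever
  \<open>a\<close> is. Superharmonicity for \<open>a\<close> thus becomes the condition
  \<open>flow\<close>, in which \<open>a\<close> does not occur, so one flow serves all
  environments.\<close>

lemma potential_superharmonic:
  assumes a: "conductance V E a" "\<And>e. e \<in> E \<Longrightarrow> 0 < a e"
    and fin: "\<And>y. y \<in> V \<Longrightarrow> \<theta> y \<noteq> \<top>" and x: "x \<in> V" "x \<noteq> root"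
    and flow: "(\<integral>\<^sup>+y. \<theta> y \<partial>count_space (children x)) \<le> \<theta> x"
  shows "walk_op V E a (potential \<theta> a) x \<le> potential \<theta> a x"
proof -
  have edge_pos: "0 < a (edge y)" if "y \<in> V" "y \<noteq> root" for y
    by (rule a(2)[OF edge_in[OF that]])
  have pot_fin: "potential \<theta> a y \<noteq> \<top>" if "y \<in> V" for y
    using ancestor[OF that] fin edge_pos
    by (auto simp: potential_def ennreal_divide_eq_top_iff ennreal_eq_0_iff not_le[symmetric])
  have incr: "ennreal (a (edge y)) * (potential \<theta> a y - potential \<theta> a (par y)) = \<theta> y"
    if y: "y \<in> V" "y \<noteq> root" for y
  proof -
    have "potential \<theta> a y - potential \<theta> a (par y) = \<theta> y / ennreal (a (edge y))"
      unfolding potential_par[OF y] using pot_fin[OF par_in[OF y]] by simp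
    then show ?thesis
      using edge_pos[OF y] by (simp add: ennreal_times_divide ennreal_mult_divide_eq mult.commute)
  qed
  have "(\<integral>\<^sup>+y. ennreal (a (edge y)) * (potential \<theta> a y - potential \<theta> a (par y)) \<partial>count_space (children x))
      = (\<integral>\<^sup>+y. \<theta> y \<partial>count_space (children x))"
  proof (rule nn_integral_cong)
    fix y assume "y \<in> space (count_space (children x))"
    then show "ennreal (a (edge y)) * (potential \<theta> a y - potential \<theta> a (par y)) = \<theta> y"
      by (intro incr) (auto simp: children_def)
  qed
  then show ?thesis
    using flow incr[OF x] a pot_fin potential_par
    by (subst walk_op_le_iff_flow[OF a x]) (auto simp: add_increasing2)
qed

end

section \<open>Barriers\<close>

text \<open>Excluding the one-vertex tree gives every vertex an edge, hence a positive total
  conductance.\<close>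

locale weighted_rooted_tree = rooted_tree V E root par depth
  for V :: "'v set" and E root par depth +
  fixes c :: "'v set \<Rightarrow> real"
  assumes cond: "conductance V E c"
    and pos: "\<And>e. e \<in> E \<Longrightarrow> 0 < c e"
    and nontrivial: "V \<noteq> {root}"
begin

lemma total_pos: "u \<in> V \<Longrightarrow> 0 < total_conductance E c u"
  using neighbour_ex[OF nontrivial] total_conductance_pos[OF cond pos] by blast

text \<open>Monotonicity away from the root is part of the definition because the flow is formed
  with the truncated subtraction of \<open>ennreal\<close>. At the root superharmonicity would
  contradict the value 0, so the root is exempt.\<close>

definition barriers :: "'v set \<Rightarrow> ('v \<Rightarrow> ennreal) set" where
  "barriers B = {w. w root = 0 \<and> (\<forall>v. w v \<le> 1) \<and>
     (\<forall>x\<in>V. x \<noteq> root \<longrightarrow> w (par x) \<le> w x \<and> walk_op V E c w x \<le> w x) \<and>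
     (\<forall>x\<in>V - B. x \<noteq> root \<longrightarrow> w x = 1)}"

definition barrier :: "'v set \<Rightarrow> 'v \<Rightarrow> ennreal" where
  "barrier B x = (INF w\<in>barriers B. w x)"

lemma barrier_le: "w \<in> barriers B \<Longrightarrow> barrier B x \<le> w x"
  unfolding barrier_def by (rule INF_lower)

lemma indicator_in_barriers: "(\<lambda>x. if x = root then 0 else 1) \<in> barriers B"
proof -
  have "walk_op V E c (\<lambda>x. if x = root then 0 else 1) x \<le> 1" if "x \<in> V" for x
    using walk_op_mono[of V "\<lambda>x. if x = root then 0 else 1" "\<lambda>_. 1" E c x]
      walk_op_const[OF simple_graph cond that total_pos[OF that], of 1] by simp
  then show ?thesis by (auto simp: barriers_def)
qed

text \<open>The averaging operator is monotone, so superharmonicity passes to infima, as do the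
  other conditions. The family contains the indicator of the non-root vertices, which keeps the
  infimum from being an empty one.\<close>

lemma barrier_in_barriers: "barrier B \<in> barriers B"
  unfolding barriers_def
proof (intro CollectI conjI ballI impI allI)
  show "barrier B root = 0" using barrier_le[OF indicator_in_barriers, of B root] by simp
  show "barrier B v \<le> 1" for v
    using barrier_le[OF indicator_in_barriers, of B v] by (auto split: if_splits)
next
  fix x assume x: "x \<in> V" "x \<noteq> root"
  have "barrier B (par x) \<le> w x" "walk_op V E c (barrier B) x \<le> w x" if w: "w \<in> barriers B" for w
  proof -
    have "w (par x) \<le> w x" "walk_op V E c w x \<le> w x" using w x by (auto simp: barriers_def)
    moreover have "walk_op V E c (barrier B) x \<le> walk_op V E c w x"
      by (intro walk_op_mono barrier_le w)
    ultimately show "barrier B (par x) \<le> w x" "walk_op V E c (barrier B) x \<le> w x"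
      using barrier_le[OF w, of "par x"] by auto
  qed
  then show "barrier B (par x) \<le> barrier B x" "walk_op V E c (barrier B) x \<le> barrier B x"
    unfolding barrier_def[of B x] by (auto intro: INF_greatest)
next
  fix x assume x: "x \<in> V - B" "x \<noteq> root"
  then have "w x = 1" if "w \<in> barriers B" for w using that by (auto simp: barriers_def)
  then have "barrier B x = (INF w\<in>barriers B. 1)" unfolding barrier_def by (intro INF_cong) auto
  then show "barrier B x = 1" using indicator_in_barriers by (subst (asm) INF_const) auto
qed

lemma barrier_antimono: "B \<subseteq> B' \<Longrightarrow> barrier B' x \<le> barrier B x"
  unfolding barrier_def by (rule INF_superset_mono) (auto simp: barriers_def)

text \<open>Lowering the value at one interior vertex \<open>x\<close> to the average over its neighbours gives
  another barrier, so the least barrier is already harmonic there.\<close>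

lemma barrier_subharmonic:
  assumes x: "x \<in> B" "x \<in> V" "x \<noteq> root"
  shows "barrier B x \<le> walk_op V E c (barrier B) x"
proof -
  let ?u = "barrier B" and ?P = "walk_op V E c"
  define u' where "u' = ?u(x := ?P ?u x)"
  have u: "?u root = 0" "?u v \<le> 1" "y \<in> V \<Longrightarrow> y \<noteq> root \<Longrightarrow> ?u (par y) \<le> ?u y"
    "y \<in> V \<Longrightarrow> y \<noteq> root \<Longrightarrow> ?P ?u y \<le> ?u y" "y \<in> V - B \<Longrightarrow> y \<noteq> root \<Longrightarrow> ?u y = 1" for v y
    using barrier_in_barriers[of B] by (auto simp: barriers_def)
  have le: "u' v \<le> ?u v" for v using u(4)[OF x(2,3)] by (simp add: u'_def)
  have P_le: "?P u' y \<le> ?P ?u y" for y by (rule walk_op_mono[OF le])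
  \<comment> \<open>Lowering the value at \<open>x\<close> must not break monotonicity: all
    neighbours of \<open>x\<close> have values at least that of the parent, hence so does their
    average.\<close>
  have par_le: "?u (par x) \<le> ?P ?u x"
  proof -
    have "?u (par x) = ?P (\<lambda>_. ?u (par x)) x"
      by (simp add: walk_op_const[OF simple_graph cond x(2) total_pos[OF x(2)]])
    also have "\<dots> \<le> ?P ?u x"
      unfolding walk_op_def
    proof (rule nn_integral_mono)
      fix v
      show "ennreal (transition_prob E c x v) * ?u (par x) \<le> ennreal (transition_prob E c x v) * ?u v"
      proof (cases "{x, v} \<in> E")
        case True
        then have "v = par x \<or> v \<in> V \<and> v \<noteq> root \<and> par v = x"
          by (auto simp: edge_iff children_def)
        then have "?u (par x) \<le> ?u v"
          using u(3)[of v] u(3)[of x] x by (auto intro: order_trans)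
        then show ?thesis by (rule mult_left_mono) simp
      qed (simp add: transition_prob_def)
    qed
    finally show ?thesis .
  qed
  have "u' \<in> barriers B"
    unfolding barriers_def
  proof (intro CollectI conjI ballI impI allI)
    show "u' root = 0" using x u(1) by (simp add: u'_def)
    show "u' v \<le> 1" for v using le[of v] u(2)[of v] by simp
    show "u' y = 1" if "y \<in> V - B" "y \<noteq> root" for y using that x u(5) by (auto simp: u'_def)
  next
    fix y assume y: "y \<in> V" "y \<noteq> root"
    show "u' (par y) \<le> u' y"
    proof (cases "y = x")
      case True
      then show ?thesis using par_le par_neq[OF x(2,3)] by (simp add: u'_def)
    next
      case False
      then show ?thesis using le[of "par y"] u(3)[OF y] by (simp add: u'_def)
    qed
    \<comment> \<open>At \<open>x\<close> the new value is the old average, which only decreases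
      when \<open>u'\<close> replaces the barrier; elsewhere the value is unchanged and the average
      is no larger.\<close>
    show "?P u' y \<le> u' y"
      using P_le[of y] u(4)[OF y] by (auto simp: u'_def)
  qed
  from barrier_le[OF this, of x] show ?thesis by (simp add: u'_def)
qed

text \<open>Every vertex lies in all late \<open>B n\<close>, so the decreasing limit of the
  barriers is subharmonic off the root. It is bounded and vanishes at the root, so recurrence forces
  it to be 0.\<close>

lemma barrier_tendsto_zero:
  assumes rec: "recurrent_graph V E c" and B: "incseq B" "(\<Union>n. B n) = V" and x: "x \<in> V"
  shows "(\<lambda>n. barrier (B n) x) \<longlonglongrightarrow> 0"
proof -
  define g where "g y = (INF n. barrier (B n) y)" for y
  have dec: "decseq (\<lambda>n. barrier (B n) y)" for y
    using B(1) by (auto simp: decseq_def incseq_def intro: barrier_antimono)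
  have in_B: "barrier (B n) root = 0" "barrier (B n) v \<le> 1" for n v
    using barrier_in_barriers[of "B n"] by (auto simp: barriers_def)
  have g_le: "g y \<le> barrier (B n) y" for n y unfolding g_def by (rule INF_lower) simp
  have "g x = 0"
  proof (rule recurrent_graph_subharmonic_zero[OF simple_graph rec
        countable_vertices[OF cond pos] total_pos _ _ _ root_in x])
    show "g root = 0" using g_le[of root 0] in_B(1) by simp
    show "g v \<le> 1" for v using g_le[of v 0] in_B(2)[of 0 v] by simp
    fix v assume v: "v \<in> V" "v \<noteq> root"
    let ?p = "\<lambda>y. ennreal (transition_prob E c v y)"
    have one: "(\<integral>\<^sup>+y. ?p y \<partial>count_space V) = 1"
      by (rule nn_integral_transition_prob[OF simple_graph cond v(1) total_pos[OF v(1)]])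
    have dec_p: "decseq (\<lambda>n. ?p y * barrier (B n) y)" for y
      using dec[of y] by (auto simp: decseq_def intro!: mult_left_mono)
    have "(INF n. ?p y * barrier (B n) y) = ?p y * g y" for y
      unfolding g_def
      by (rule LIMSEQ_unique[OF LIMSEQ_INF[OF dec_p] ennreal_tendsto_cmult[OF _ LIMSEQ_INF[OF dec]]])
        simp
    then have "walk_op V E c g v = (\<integral>\<^sup>+y. (INF n. ?p y * barrier (B n) y) \<partial>count_space V)"
      by (simp add: walk_op_def)
    \<comment> \<open>Monotone convergence for a decreasing sequence, which needs one finite
      integral: the first is at most 1.\<close>
    also have "\<dots> = (INF n. walk_op V E c (barrier (B n)) v)"
      unfolding walk_op_def
    proof (rule nn_integral_monotone_convergence_INF_decseq)
      show "decseq (\<lambda>n y. ?p y * barrier (B n) y)"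
        by (intro decseq_SucI le_funI decseq_SucD[OF dec_p])
      have "(\<integral>\<^sup>+y. ?p y * barrier (B 0) y \<partial>count_space V) \<le> (\<integral>\<^sup>+y. ?p y * 1 \<partial>count_space V)"
        using in_B(2) by (intro nn_integral_mono mult_left_mono) auto
      then show "(\<integral>\<^sup>+y. ?p y * barrier (B 0) y \<partial>count_space V) < \<infinity>"
        using one by (simp add: le_less_trans)
    qed auto
    finally have op: "walk_op V E c g v = (INF n. walk_op V E c (barrier (B n)) v)" .
    obtain m where m: "v \<in> B m" using B(2) v by blast
    have "g v \<le> walk_op V E c (barrier (B n)) v" for n
    proof -
      \<comment> \<open>Late enough for \<open>v\<close> to be interior, and for the barrier to lie
        below the one for \<open>B n\<close>.\<close>
      let ?k = "max m n"
      have sub: "B m \<subseteq> B ?k" "B n \<subseteq> B ?k" using B(1) by (auto simp: incseq_def)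
      have "g v \<le> barrier (B ?k) v" by (rule g_le)
      also have "\<dots> \<le> walk_op V E c (barrier (B ?k)) v"
        using m sub v by (intro barrier_subharmonic) auto
      also have "\<dots> \<le> walk_op V E c (barrier (B n)) v"
        by (intro walk_op_mono barrier_antimono sub)
      finally show ?thesis .
    qed
    then show "g v \<le> walk_op V E c g v" unfolding op by (intro INF_greatest)
  qed
  then show ?thesis using LIMSEQ_INF[OF dec, of x] by (simp add: g_def)
qed

section \<open>The flow of a barrier\<close>

definition flow :: "('v \<Rightarrow> ennreal) \<Rightarrow> 'v \<Rightarrow> ennreal" where
  "flow w x = ennreal (c (edge x)) * (w x - w (par x))"

lemma barriers_finite: "w \<in> barriers B \<Longrightarrow> w x \<noteq> \<top>"
  using neq_top_trans[of 1 "w x"] by (simp add: barriers_def)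

lemma flow_finite: "w \<in> barriers B \<Longrightarrow> flow w x \<noteq> \<top>"
  unfolding flow_def using barriers_finite[of w B x]
  by (auto simp: ennreal_mult_eq_top_iff)

lemma flow_children_le:
  assumes w: "w \<in> barriers B" and x: "x \<in> V" "x \<noteq> root"
  shows "(\<integral>\<^sup>+y. flow w y \<partial>count_space (children x)) \<le> flow w x"
  unfolding flow_def
  using walk_op_le_iff_flow[OF cond pos x, of w] w x barriers_finite[OF w]
  by (auto simp: barriers_def)

text \<open>The voltage drops telescope along the path to the root, where \<open>w\<close> vanishes.
  With \<open>potential_antimono\<close> this makes \<open>w\<close> a lower bound for the potential
  in every environment below \<open>c\<close>.\<close>

lemma potential_flow:
  assumes w: "w \<in> barriers B" and "x \<in> V"
  shows "potential (flow w) c x = w x"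
  using assms(2)
proof (induction rule: rooted_induct)
  case root
  then show ?case using w by (simp add: potential_root barriers_def)
next
  case (step x)
  have "w (par x) \<le> w x" using w step by (auto simp: barriers_def)
  moreover have "flow w x / ennreal (c (edge x)) = w x - w (par x)"
    unfolding flow_def using pos[OF edge_in[OF step(1,2)]]
    by (simp add: ennreal_mult_divide_eq mult.commute[of "ennreal _"])
  ultimately show ?case
    using step by (simp add: potential_par add_diff_inverse_ennreal)
qed

end

section \<open>Walks in a bounded increasing environment\<close>

locale bounded_rwce = rwce M V E X C + weighted_rooted_tree V E root par depth c
  for M :: "'a measure" and V :: "'v set" and E X C root par depth c +
  assumes environment: "AE \<omega> in M. \<forall>t. conductance V E (C t \<omega>) \<and>
      (\<forall>e\<in>E. 0 < C t \<omega> e \<and> C t \<omega> e \<le> C (Suc t) \<omega> e \<and> C t \<omega> e \<le> c e)"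
begin

lemma countable_V: "countable V"
  by (rule countable_vertices[OF cond pos])

section \<open>The supermartingale and the absence of escape\<close>

lemma potential_measurable:
  assumes "v \<in> V"
  shows "(\<lambda>\<omega>. potential \<theta> (C t \<omega>) v) \<in> borel_measurable (history M V E X C t)"
proof -
  have "(\<lambda>\<omega>. \<theta> y / ennreal (C t \<omega> (edge y))) \<in> borel_measurable (history M V E X C t)"
    if "y \<in> V" "y \<noteq> root" for y
    using measurable_history_conductance[OF order_refl edge_in[OF that]] by measurable
  then show ?thesis
    unfolding potential_def using ancestor[OF assms] by (intro borel_measurable_sum) auto
qed

text \<open>Both halves of a step lower the mean: the growth of the conductances by
  \<open>potential_antimono\<close>, and the move of the walk by
  \<open>potential_superharmonic\<close>. The latter fails at the root, hence the restriction to
  paths avoiding it. The event \<open>A\<close> will fix the situation at time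
  \<open>s\<close>.\<close>

lemma potential_supermartingale:
  assumes A: "\<And>t. s \<le> t \<Longrightarrow> A \<in> sets (history M V E X C t)"
    and fin: "\<And>y. y \<in> V \<Longrightarrow> \<theta> y \<noteq> \<top>"
    and flow: "\<And>x. x \<in> V \<Longrightarrow> x \<noteq> root \<Longrightarrow> (\<integral>\<^sup>+y. \<theta> y \<partial>count_space (children x)) \<le> \<theta> x"
    and "s \<le> t"
  shows "(\<integral>\<^sup>+\<omega>. indicator {\<omega> \<in> A. \<forall>r\<in>{s..t}. X r \<omega> \<noteq> root} \<omega> * potential \<theta> (C t \<omega>) (X t \<omega>) \<partial>M)
    \<le> (\<integral>\<^sup>+\<omega>. indicator A \<omega> * potential \<theta> (C s \<omega>) (X s \<omega>) \<partial>M)"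
    (is "?e t \<le> _")
  using \<open>s \<le> t\<close>
proof (induction t rule: dec_induct)
  case base
  show ?case by (intro nn_integral_mono mult_right_mono) (auto split: split_indicator)
next
  case (step t)
  let ?A = "\<lambda>t. {\<omega> \<in> A. \<forall>r\<in>{s..t}. X r \<omega> \<noteq> root}"
  have space: "A \<subseteq> space M" using sets.sets_into_space[OF A[OF order_refl]] by (simp add: space_history)
  have "?A t = A \<inter> (\<Inter>r\<in>{s..t}. {\<omega> \<in> space M. X r \<omega> \<noteq> root})"
    using space by (cases "s \<le> t") auto
  also have "\<dots> \<in> sets (history M V E X C t)"
    using step(1) by (intro sets.Int A sets.finite_INT sets_history_position) auto
  finally have A_t: "?A t \<in> sets (history M V E X C t)" .
  \<comment> \<open>\<open>C (Suc t)\<close> may depend on the position at time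
    \<open>t + 1\<close>, so it is first replaced by \<open>C t\<close>, which belongs to the
    history. This is how monotonicity copes with adaptive environments.\<close>
  have "?e (Suc t) \<le> (\<integral>\<^sup>+\<omega>. indicator (?A t) \<omega> * potential \<theta> (C t \<omega>) (X (Suc t) \<omega>) \<partial>M)"
  proof (rule nn_integral_mono_AE, use environment AE_space in eventually_elim)
    fix \<omega> assume *: "\<forall>t. conductance V E (C t \<omega>) \<and>
      (\<forall>e\<in>E. 0 < C t \<omega> e \<and> C t \<omega> e \<le> C (Suc t) \<omega> e \<and> C t \<omega> e \<le> c e)" "\<omega> \<in> space M"
    have "potential \<theta> (C (Suc t) \<omega>) (X (Suc t) \<omega>) \<le> potential \<theta> (C t \<omega>) (X (Suc t) \<omega>)"
      using * by (intro potential_antimono position_in) auto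
    then show "indicator (?A (Suc t)) \<omega> * potential \<theta> (C (Suc t) \<omega>) (X (Suc t) \<omega>)
      \<le> indicator (?A t) \<omega> * potential \<theta> (C t \<omega>) (X (Suc t) \<omega>)"
      by (intro mult_mono) (auto split: split_indicator)
  qed
  also have "\<dots> = (\<integral>\<^sup>+\<omega>. \<integral>\<^sup>+v. ennreal (transition_prob E (C t \<omega>) (X t \<omega>) v) *
      (indicator (?A t) \<omega> * potential \<theta> (C t \<omega>) v) \<partial>count_space V \<partial>M)"
    by (intro nn_integral_next_position countable_V borel_measurable_times_ennreal
        borel_measurable_indicator A_t potential_measurable)
  also have "\<dots> \<le> ?e t"
  proof (rule nn_integral_mono_AE, use environment AE_space in eventually_elim)
    fix \<omega> assume *: "\<forall>t. conductance V E (C t \<omega>) \<and>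
      (\<forall>e\<in>E. 0 < C t \<omega> e \<and> C t \<omega> e \<le> C (Suc t) \<omega> e \<and> C t \<omega> e \<le> c e)" "\<omega> \<in> space M"
    show "(\<integral>\<^sup>+v. ennreal (transition_prob E (C t \<omega>) (X t \<omega>) v) *
      (indicator (?A t) \<omega> * potential \<theta> (C t \<omega>) v) \<partial>count_space V)
      \<le> indicator (?A t) \<omega> * potential \<theta> (C t \<omega>) (X t \<omega>)"
    proof (cases "\<omega> \<in> ?A t")
      case True
      then have "X t \<omega> \<noteq> root" using step(1) by auto
      then have "walk_op V E (C t \<omega>) (potential \<theta> (C t \<omega>)) (X t \<omega>) \<le> potential \<theta> (C t \<omega>) (X t \<omega>)"
        using * by (intro potential_superharmonic fin flow position_in) auto
      then show ?thesis using True by (simp add: walk_op_def)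
    qed simp
  qed
  finally show ?case using step.IH by (rule order_trans)
qed

text \<open>Fixing \<open>x\<close> and \<open>\<delta>\<close> bounds the random potential at time
  \<open>s\<close> by a constant \<open>b n\<close> that tends to 0. When the walk has avoided the
  root and is outside \<open>B n\<close>, its potential is at least 1, so on \<open>A\<close> this
  has probability at most \<open>b n\<close> at each time.\<close>

lemma AE_no_escape:
  assumes rec: "recurrent_graph V E c" and B: "incseq B" "(\<Union>n. B n) = V"
    and x: "x \<in> V" and \<delta>: "0 < \<delta>"
  shows "AE \<omega> in M. X s \<omega> = x \<longrightarrow> (\<forall>i<depth x. \<delta> \<le> C s \<omega> (edge ((par ^^ i) x))) \<longrightarrow>
    (\<forall>r\<ge>s. X r \<omega> \<noteq> root) \<longrightarrow> \<not> (\<forall>n. \<forall>\<^sub>F t in sequentially. X t \<omega> \<notin> B n)"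
proof -
  let ?y = "\<lambda>i. (par ^^ i) x"
  define A where "A = {\<omega> \<in> space M. X s \<omega> = x \<and> (\<forall>i<depth x. \<delta> \<le> C s \<omega> (edge (?y i)))}"
  have A: "A \<in> sets (history M V E X C t)" if "s \<le> t" for t
  proof -
    \<comment> \<open>For \<open>x = root\<close> the path is empty and the inner intersection is
      everything, hence the extra \<open>space M\<close>.\<close>
    have "A = {\<omega> \<in> space M. X s \<omega> = x} \<inter>
        ((\<Inter>i\<in>{..<depth x}. {\<omega> \<in> space M. \<delta> \<le> C s \<omega> (edge (?y i))}) \<inter> space M)"
      by (auto simp: A_def)
    also have "\<dots> \<in> sets (history M V E X C t)"
    proof (cases "depth x = 0")
      case True
      then show ?thesis
        using sets_history_position[OF that, of "\<lambda>v. v = x"]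
          sets.top[of "history M V E X C t"] by (auto simp: space_history)
    next
      case False
      then show ?thesis
        using ancestor[OF x] that sets.top[of "history M V E X C t"]
        by (intro sets.Int sets.finite_INT sets_history_position sets_history_conductance edge_in)
          (auto simp: space_history)
    qed
    finally show ?thesis .
  qed
  define G where "G n t = {\<omega> \<in> space M. \<omega> \<in> A \<and> (\<forall>r\<in>{s..t}. X r \<omega> \<noteq> root) \<and> X t \<omega> \<notin> B n}" for n t
  have G: "G n t \<in> sets M" for n t
  proof -
    have "G n t = A \<inter> ((\<Inter>r\<in>{..t}. {\<omega> \<in> space M. s \<le> r \<longrightarrow> X r \<omega> \<noteq> root}) \<inter>
        {\<omega> \<in> space M. X t \<omega> \<notin> B n})"
      by (auto simp: G_def)
    also have "\<dots> \<in> sets M"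
      using sets_history_imp_sets[OF A[OF order_refl]]
      by (intro sets.Int sets.finite_INT sets_position) auto
    finally show ?thesis .
  qed
  \<comment> \<open>The flow of a barrier is at most \<open>c\<close> times its value at the lower
    end point, and the conductance dividing it is at least \<open>\<delta>\<close>.\<close>
  define b where "b n = (\<Sum>i<depth x. ennreal (c (edge (?y i))) / ennreal \<delta> * barrier (B n) (?y i))" for n
  have G_le: "emeasure M (G n t) \<le> b n" if "s \<le> t" for n t
  proof -
    let ?w = "barrier (B n)"
    have w: "?w \<in> barriers (B n)" by (rule barrier_in_barriers)
    have "emeasure M (G n t) = (\<integral>\<^sup>+\<omega>. indicator (G n t) \<omega> \<partial>M)" using G by simp
    also have "\<dots> \<le> (\<integral>\<^sup>+\<omega>. indicator {\<omega> \<in> A. \<forall>r\<in>{s..t}. X r \<omega> \<noteq> root} \<omega> *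
        potential (flow ?w) (C t \<omega>) (X t \<omega>) \<partial>M)"
    proof (rule nn_integral_mono_AE, use environment in eventually_elim)
      fix \<omega> assume *: "\<forall>t. conductance V E (C t \<omega>) \<and>
        (\<forall>e\<in>E. 0 < C t \<omega> e \<and> C t \<omega> e \<le> C (Suc t) \<omega> e \<and> C t \<omega> e \<le> c e)"
      show "indicator (G n t) \<omega> \<le> indicator {\<omega> \<in> A. \<forall>r\<in>{s..t}. X r \<omega> \<noteq> root} \<omega> *
        potential (flow ?w) (C t \<omega>) (X t \<omega>)"
      proof (cases "\<omega> \<in> G n t")
        case True
        then have "X t \<omega> \<in> V - B n" "X t \<omega> \<noteq> root"
          using position_in that by (auto simp: G_def)
        then have "1 = potential (flow ?w) c (X t \<omega>)"
          using w potential_flow[OF w, of "X t \<omega>"] by (simp add: barriers_def)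
        also have "\<dots> \<le> potential (flow ?w) (C t \<omega>) (X t \<omega>)"
          using * \<open>X t \<omega> \<in> V - B n\<close> by (intro potential_antimono) auto
        finally show ?thesis using True by (simp add: G_def)
      qed simp
    qed
    also have "\<dots> \<le> (\<integral>\<^sup>+\<omega>. indicator A \<omega> * potential (flow ?w) (C s \<omega>) (X s \<omega>) \<partial>M)"
      using that by (intro potential_supermartingale A flow_finite[OF w] flow_children_le[OF w])
    also have "\<dots> \<le> (\<integral>\<^sup>+\<omega>. b n \<partial>M)"
    proof (rule nn_integral_mono)
      fix \<omega> assume "\<omega> \<in> space M"
      show "indicator A \<omega> * potential (flow ?w) (C s \<omega>) (X s \<omega>) \<le> b n"
      proof (cases "\<omega> \<in> A")
        case True
        have "potential (flow ?w) (C s \<omega>) x \<le> b n"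
          unfolding potential_def b_def
        proof (rule sum_mono)
          fix i assume "i \<in> {..<depth x}"
          then have \<delta>_le: "\<delta> \<le> C s \<omega> (edge (?y i))" using True by (simp add: A_def)
          have "flow ?w (?y i) \<le> ennreal (c (edge (?y i))) * ?w (?y i)"
            unfolding flow_def by (intro mult_left_mono diff_le_self_ennreal) simp
          moreover have "inverse (ennreal (C s \<omega> (edge (?y i)))) \<le> inverse (ennreal \<delta>)"
            using \<delta> \<delta>_le by (simp add: inverse_ennreal ennreal_leI le_imp_inverse_le)
          ultimately show "flow ?w (?y i) / ennreal (C s \<omega> (edge (?y i))) \<le>
              ennreal (c (edge (?y i))) / ennreal \<delta> * ?w (?y i)"
            unfolding ennreal_divide_times ennreal_times_divide
            unfolding divide_ennreal_def by (intro mult_mono) auto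
        qed
        then show ?thesis using True by (simp add: A_def)
      qed simp
    qed
    finally show ?thesis by (simp add: emeasure_space_1)
  qed
  have b: "b \<longlonglongrightarrow> 0"
  proof -
    have "(\<lambda>n. ennreal (c (edge (?y i))) / ennreal \<delta> * barrier (B n) (?y i)) \<longlonglongrightarrow>
        ennreal (c (edge (?y i))) / ennreal \<delta> * 0" if "i < depth x" for i
      using ancestor[OF x that] \<delta>
      by (intro ennreal_tendsto_cmult barrier_tendsto_zero rec B)
        (auto simp: less_top[symmetric] ennreal_divide_eq_top_iff)
    then have "b \<longlonglongrightarrow> (\<Sum>i<depth x. ennreal (c (edge (?y i))) / ennreal \<delta> * 0)"
      unfolding b_def by (intro tendsto_sum) auto
    then show ?thesis by simp
  qed
  \<comment> \<open>The walk may return to \<open>B n\<close>, so \<open>G n t\<close> is not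
    monotone in \<open>t\<close>. This lower limit is 1 if \<open>G n t\<close> holds for all late
    \<open>t\<close>, and Fatou's lemma carries the bound \<open>b n\<close> over to it.\<close>
  define f where "f n \<omega> = liminf (\<lambda>t. indicator (G n t) \<omega> :: ennreal)" for n \<omega>
  have f: "f n \<in> borel_measurable M" for n
    unfolding f_def[abs_def] using G by measurable
  have f_le: "(\<integral>\<^sup>+\<omega>. f n \<omega> \<partial>M) \<le> b n" for n
  proof -
    have "(\<integral>\<^sup>+\<omega>. f n \<omega> \<partial>M) \<le> liminf (\<lambda>t. \<integral>\<^sup>+\<omega>. indicator (G n t) \<omega> \<partial>M)"
      unfolding f_def using G by (intro nn_integral_liminf) auto
    also have "\<dots> = liminf (\<lambda>t. emeasure M (G n t))" using G by simp
    also have "\<dots> \<le> limsup (\<lambda>t. emeasure M (G n t))" by (rule Liminf_le_Limsup) simp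
    also have "\<dots> \<le> b n"
      by (rule Limsup_bounded) (use G_le in \<open>auto simp: eventually_sequentially\<close>)
    finally show ?thesis .
  qed
  have "(\<integral>\<^sup>+\<omega>. (INF n. f n \<omega>) \<partial>M) \<le> b n" for n
    using f_le[of n] by (rule order_trans[rotated]) (auto intro!: nn_integral_mono INF_lower)
  with b have "(\<integral>\<^sup>+\<omega>. (INF n. f n \<omega>) \<partial>M) \<le> 0"
    by (intro Lim_bounded2[of b 0]) auto
  then have "AE \<omega> in M. (INF n. f n \<omega>) = 0"
    using f by (subst (asm) le_zero_eq, subst (asm) nn_integral_0_iff_AE) auto
  with AE_space show ?thesis
  proof eventually_elim
    fix \<omega> assume \<omega>: "\<omega> \<in> space M" and inf: "(INF n. f n \<omega>) = 0"
    show "X s \<omega> = x \<longrightarrow> (\<forall>i<depth x. \<delta> \<le> C s \<omega> (edge ((par ^^ i) x))) \<longrightarrow>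
      (\<forall>r\<ge>s. X r \<omega> \<noteq> root) \<longrightarrow> \<not> (\<forall>n. \<forall>\<^sub>F t in sequentially. X t \<omega> \<notin> B n)"
    proof (intro impI notI)
      assume *: "X s \<omega> = x" "\<forall>i<depth x. \<delta> \<le> C s \<omega> (edge ((par ^^ i) x))"
        "\<forall>r\<ge>s. X r \<omega> \<noteq> root" "\<forall>n. \<forall>\<^sub>F t in sequentially. X t \<omega> \<notin> B n"
      have "1 \<le> f n \<omega>" for n
        unfolding f_def
      proof (rule Liminf_bounded)
        show "\<forall>\<^sub>F t in sequentially. 1 \<le> (indicator (G n t) \<omega> :: ennreal)"
          using *(4)[rule_format, of n] by eventually_elim (use * \<omega> in \<open>simp add: G_def A_def\<close>)
      qed
      then have "1 \<le> (INF n. f n \<omega>)" by (intro INF_greatest)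
      with inf show False by simp
    qed
  qed
qed

lemma AE_infinite_visits_edge:
  assumes xy: "{x, y} \<in> E"
  shows "AE \<omega> in M. infinite {t. X t \<omega> = x} \<longrightarrow> infinite {t. X t \<omega> = y}"
proof (rule AE_infinite_visits_neighbour[OF xy])
  show x: "x \<in> V" and "y \<in> V" "x \<noteq> y" using edge_memD[OF xy] by auto
  show "AE \<omega> in M. \<forall>s t. s \<le> t \<longrightarrow> C s \<omega> {x, y} \<le> C t \<omega> {x, y}"
    using environment
  proof eventually_elim
    fix \<omega> assume *: "\<forall>t. conductance V E (C t \<omega>) \<and>
      (\<forall>e\<in>E. 0 < C t \<omega> e \<and> C t \<omega> e \<le> C (Suc t) \<omega> e \<and> C t \<omega> e \<le> c e)"
    then have "C t \<omega> {x, y} \<le> C (Suc t) \<omega> {x, y}" for t using xy by blast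
    then show "\<forall>s t. s \<le> t \<longrightarrow> C s \<omega> {x, y} \<le> C t \<omega> {x, y}"
      using lift_Suc_mono_le[of "\<lambda>t. C t \<omega> {x, y}"] by blast
  qed
  show "AE \<omega> in M. \<forall>t. 0 < C t \<omega> {x, y}"
    using environment by eventually_elim (use xy in auto)
  \<comment> \<open>The dominating weights supply the uniform bound on the total conductance at
    \<open>x\<close>.\<close>
  show "AE \<omega> in M. \<forall>t. 0 < total_conductance E (C t \<omega>) x \<and>
      total_conductance E (C t \<omega>) x \<le> total_conductance E c x"
    using environment
  proof eventually_elim
    fix \<omega> assume *: "\<forall>t. conductance V E (C t \<omega>) \<and>
      (\<forall>e\<in>E. 0 < C t \<omega> e \<and> C t \<omega> e \<le> C (Suc t) \<omega> e \<and> C t \<omega> e \<le> c e)"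
    have "total_conductance E (C t \<omega>) x \<le> total_conductance E c x" for t
      unfolding total_conductance_def
      using * cond x by (intro infsum_mono) (auto simp: conductance_def)
    moreover have "0 < total_conductance E (C t \<omega>) x" for t
      using * x by (intro total_conductance_pos[OF _ _ xy]) auto
    ultimately show "\<forall>t. 0 < total_conductance E (C t \<omega>) x \<and>
      total_conductance E (C t \<omega>) x \<le> total_conductance E c x" by blast
  qed
qed (rule total_pos, use edge_memD[OF xy] in blast)

text \<open>By connectedness either all vertices are visited infinitely often or none is. In the
  second case the walk eventually leaves every finite set, and after its last visit to the root this
  contradicts \<open>AE_no_escape\<close>.\<close>

lemma recurrent:
  assumes rec: "recurrent_graph V E c"
  shows "recurrent_walk M V X"
proof -
  \<comment> \<open>Finite sets exhausting \<open>V\<close>, taken from an enumeration.\<close>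
  define B where "B n = from_nat_into V ` {..<n}" for n
  have B: "incseq B" "(\<Union>n. B n) = V"
  proof -
    show "incseq B" unfolding B_def incseq_def by (auto intro!: image_mono)
    have "(\<Union>n. B n) = range (from_nat_into V)" unfolding B_def by blast
    also have "\<dots> = V" using root_in countable_V by (intro range_from_nat_into) auto
    finally show "(\<Union>n. B n) = V" .
  qed
  have edge_visits: "AE \<omega> in M. \<forall>x\<in>V. \<forall>y\<in>V. {x, y} \<in> E \<longrightarrow>
      infinite {t. X t \<omega> = x} \<longrightarrow> infinite {t. X t \<omega> = y}"
    using AE_infinite_visits_edge by (auto simp: AE_ball_countable[OF countable_V])
  \<comment> \<open>Restricting \<open>\<delta>\<close> to the values \<open>1 / (k + 1)\<close>
    leaves only countably many exceptional null sets.\<close>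
  have no_escape: "AE \<omega> in M. \<forall>s. \<forall>x\<in>V. \<forall>k. X s \<omega> = x \<longrightarrow>
      (\<forall>i<depth x. 1 / real (Suc k) \<le> C s \<omega> (edge ((par ^^ i) x))) \<longrightarrow>
      (\<forall>r\<ge>s. X r \<omega> \<noteq> root) \<longrightarrow> \<not> (\<forall>n. \<forall>\<^sub>F t in sequentially. X t \<omega> \<notin> B n)"
    unfolding AE_all_countable AE_ball_countable[OF countable_V]
    by (intro allI ballI AE_no_escape[OF rec B]) auto
  show ?thesis
    unfolding recurrent_walk_def
    using environment edge_visits no_escape AE_space
  proof eventually_elim
    fix \<omega> assume env: "\<forall>t. conductance V E (C t \<omega>) \<and>
        (\<forall>e\<in>E. 0 < C t \<omega> e \<and> C t \<omega> e \<le> C (Suc t) \<omega> e \<and> C t \<omega> e \<le> c e)"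
      and nb: "\<forall>x\<in>V. \<forall>y\<in>V. {x, y} \<in> E \<longrightarrow>
        infinite {t. X t \<omega> = x} \<longrightarrow> infinite {t. X t \<omega> = y}"
      and esc: "\<forall>s. \<forall>x\<in>V. \<forall>k. X s \<omega> = x \<longrightarrow>
        (\<forall>i<depth x. 1 / real (Suc k) \<le> C s \<omega> (edge ((par ^^ i) x))) \<longrightarrow>
        (\<forall>r\<ge>s. X r \<omega> \<noteq> root) \<longrightarrow> \<not> (\<forall>n. \<forall>\<^sub>F t in sequentially. X t \<omega> \<notin> B n)"
      and \<omega>: "\<omega> \<in> space M"
    have iff: "infinite {t. X t \<omega> = x} \<longleftrightarrow> infinite {t. X t \<omega> = root}" if "x \<in> V" for x
      using that
    proof (induction rule: rooted_induct)
      case (step x)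
      have "infinite {t. X t \<omega> = x} \<longleftrightarrow> infinite {t. X t \<omega> = par x}"
        using nb[rule_format, of x "par x"] nb[rule_format, of "par x" x] edge_in[of x] par_in[of x] step
        by (auto simp: insert_commute)
      with step show ?case by simp
    qed simp
    have "infinite {t. X t \<omega> = root}"
    proof
      assume fin: "finite {t. X t \<omega> = root}"
      have ev: "\<forall>\<^sub>F t in sequentially. X t \<omega> \<notin> B n" for n
      proof -
        have "finite (\<Union>x\<in>B n. {t. X t \<omega> = x})"
          using iff fin B(2) by (intro finite_UN_I) (auto simp: B_def)
        then have "finite {t. X t \<omega> \<in> B n}" by (rule rev_finite_subset) auto
        then show ?thesis by (simp add: eventually_cofinite cofinite_eq_sequentially[symmetric])
      qed
      obtain s where s: "\<And>r. s \<le> r \<Longrightarrow> X r \<omega> \<noteq> root"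
        using fin unfolding finite_nat_iff_bounded by (fastforce simp: not_less[symmetric])
      let ?x = "X s \<omega>"
      have x: "?x \<in> V" by (rule position_in[OF \<omega>])
      have pos_edge: "0 < C s \<omega> (edge ((par ^^ i) ?x))" if "i < depth ?x" for i
        using env edge_in ancestor[OF x that] by blast
      \<comment> \<open>The path to the root has finitely many edges, so their conductances at time
        \<open>s\<close> have a positive minimum; inserting 1 covers the empty path.\<close>
      obtain k where k: "\<And>i. i < depth ?x \<Longrightarrow> 1 / real (Suc k) \<le> C s \<omega> (edge ((par ^^ i) ?x))"
      proof -
        let ?m = "Min (insert 1 ((\<lambda>i. C s \<omega> (edge ((par ^^ i) ?x))) ` {..<depth ?x}))"
        have "0 < ?m" using pos_edge by (subst Min_gr_iff) auto
        then obtain k where "1 / real (Suc k) < ?m"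
          using reals_Archimedean[of ?m] by (auto simp: inverse_eq_divide)
        then have "1 / real (Suc k) \<le> C s \<omega> (edge ((par ^^ i) ?x))" if "i < depth ?x" for i
          using that by (auto simp: less_imp_le)
        then show thesis by (rule that)
      qed
      show False
        using esc[rule_format, OF x refl k] s ev by blast
    qed
    then show "\<forall>v\<in>V. infinite {t. X t \<omega> = v}" using iff by blast
  qed
qed

end

section \<open>Reduction to a rooted tree with more than one vertex\<close>

theorem theorem5p1:
  fixes M :: "'a measure" and V :: "'v set" and E :: "'v set set"
    and X :: "nat \<Rightarrow> 'a \<Rightarrow> 'v" and C :: "nat \<Rightarrow> 'a \<Rightarrow> 'v set \<Rightarrow> real"
    and Cinf :: "'v set \<Rightarrow> real"
  assumes "tree_graph V E"
    and "rwce M V E X C"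
    and "proper M E C"
    and "monotone_increasing M E C"
    and "recurrent_graph V E Cinf"
    and "AE \<omega> in M. \<forall>t. \<forall>e\<in>E. C t \<omega> e \<le> Cinf e"
  shows "recurrent_walk M V X"
proof -
  interpret rwce M V E X C by fact
  obtain r where r: "r \<in> V"
    using assms(1) unfolding tree_graph_def connected_graph_def by blast
  obtain par depth where "rooted_tree V E r par depth"
    using tree_graph_rooted[OF assms(1) r] by blast
  then interpret rooted_tree V E r par depth .
  have mono: "AE \<omega> in M. \<forall>t. \<forall>e\<in>E. C t \<omega> e \<le> C (Suc t) \<omega> e"
    using assms(4) unfolding monotone_increasing_def by (simp add: AE_all_countable)
  have environment: "AE \<omega> in M. \<forall>t. conductance V E (C t \<omega>) \<and>
      (\<forall>e\<in>E. 0 < C t \<omega> e \<and> C t \<omega> e \<le> C (Suc t) \<omega> e \<and> C t \<omega> e \<le> Cinf e)"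
    using conductance assms(3)[unfolded proper_def] mono assms(6) by eventually_elim blast
  show ?thesis
  proof (cases "V = {r}")
    case True
    have "{t. X t \<omega> = r} = UNIV" if "\<omega> \<in> space M" for \<omega>
      using position_in[OF that] True by auto
    then show ?thesis
      unfolding recurrent_walk_def using True by (intro AE_I2) simp
  next
    case False
    \<comment> \<open>\<open>Cinf\<close> is deterministic, so a single sample point with
      \<open>0 < C t \<omega> e \<le> Cinf e\<close> suffices; one exists because the property has
      probability one.\<close>
    have "0 < Cinf e" if "e \<in> E" for e
    proof -
      have "\<exists>\<omega>. \<forall>t. conductance V E (C t \<omega>) \<and>
          (\<forall>e\<in>E. 0 < C t \<omega> e \<and> C t \<omega> e \<le> C (Suc t) \<omega> e \<and> C t \<omega> e \<le> Cinf e)"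
        using eventually_happens[OF environment] by (simp add: ae_filter_eq_bot_iff emeasure_space_1)
      then show ?thesis using that by (meson less_le_trans)
    qed
    then interpret bounded_rwce M V E X C r par depth Cinf
      using assms(5) False environment by unfold_locales (auto simp: recurrent_graph_def)
    show ?thesis by (rule recurrent[OF assms(5)])
  qed
qed

end
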